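(* Let $k\in\mathbb{N}$, $\alpha\in(0,1]$, $K>0$, and let $\Omega^{ext}\subset\mathbb{R}^3$ be an open ball. Let $$U^{ad}_{k,\alpha}=\left\{\Phi\in[\mathscr{D}^{k,\alpha}(\overline{\Omega^{ext}})]^3\ :\ \|\Phi\|_{[C^{k,\alpha}(\Omega^{ext})]^3}\le K,\ \|\Phi^{-1}\|_{[C^{k,\alpha}(\Omega^{ext})]^3}\le K\right\}.$$ Then $U^{ad}_{k,\alpha}$ is compact in the Banach space $\left([C^{k,\alpha'}(\overline{\Omega^{ext}})]^3,\|\cdot\|_{[C^{k,\alpha'}(\Omega^{ext})]^3}\right)$ for any $0\le\alpha'<\alpha$.
   Context: $[C^{k,\alpha}(\overline{\Omega^{ext}})]^3$ is the usual Hölder space of $\mathbb{R}^3$-valued functions with norm $\|\Phi\|_{k,\alpha}=\|\Phi\|_{C^k}+\sup_{x\neq y,\,|\beta|=k}\frac{|D^\beta\Phi(x)-D^\beta\Phi(y)|}{|x-y|^\alpha}$ (for $\alpha'=0$, $C^{k,0}=C^k$). $[\mathscr{D}^{k,\alpha}(\overline{\Omega^{ext}})]^3$ denotes the set of $C^{k,\alpha}$-diffeomorphisms of $\overline{\Omega^{ext}}$ onto itself, i.e. bijections $\Phi:\overline{\Omega^{ext}}\to\overline{\Omega^{ext}}$ with $\Phi,\Phi^{-1}\in[C^{k,\alpha}(\overline{\Omega^{ext}})]^3$. In the paper $\Omega^{ext}=B_R(z)$ is a ball containing the closures of all shapes $\Phi(\Omega_b)$, $\Phi\in U^{ad}_{k,\alpha}$,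 where $\Omega_b$ is a fixed baseline design (a bounded $C^{k,\alpha}$-domain from which an interior ball centred at $z$ has been removed). *)

theory Defs
  imports "HOL-Analysis.Analysis"
begin

text \<open>
  Throughout, \<open>S\<close> is meant to be a bounded, nonempty, open subset of \<open>\<real>\<^sup>3\<close>.
\<close>

definition partial :: "3 \<Rightarrow> (real^3 \<Rightarrow> real^3) \<Rightarrow> real^3 \<Rightarrow> real^3" where
  "partial i f x = vector_derivative (\<lambda>t. f (x + t *\<^sub>R axis i 1)) (at 0)"

text \<open>
  A multi-index is a function \<open>\<beta> :: 3 \<Rightarrow> nat\<close>. In the type \<open>3\<close> the numeral \<open>3\<close> equals \<open>0\<close>,
  so that \<open>1, 2, 3\<close> are exactly the three coordinate indices.
\<close>

definition mi_order :: "(3 \<Rightarrow> nat) \<Rightarrow> nat" where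
  "mi_order \<beta> = (\<Sum>i\<in>UNIV. \<beta> i)"

definition mi_deriv :: "(3 \<Rightarrow> nat) \<Rightarrow> (real^3 \<Rightarrow> real^3) \<Rightarrow> real^3 \<Rightarrow> real^3" where
  "mi_deriv \<beta> f = (partial 1 ^^ \<beta> 1) ((partial 2 ^^ \<beta> 2) ((partial 3 ^^ \<beta> 3) f))"

text \<open>
  \<open>Ck_on k f S\<close>: all iterated partial derivatives of \<open>f\<close> of order at most \<open>k\<close> (in every order
  of differentiation) exist and are continuous on the open set \<open>S\<close>.
\<close>

primrec Ck_on :: "nat \<Rightarrow> (real^3 \<Rightarrow> real^3) \<Rightarrow> (real^3) set \<Rightarrow> bool" where
  "Ck_on 0 f S \<longleftrightarrow> continuous_on S f"
| "Ck_on (Suc k) f S \<longleftrightarrow> continuous_on S f \<and>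
     (\<forall>i. (\<forall>x\<in>S. (\<lambda>t. f (x + t *\<^sub>R axis i 1)) differentiable (at 0)) \<and> Ck_on k (partial i f) S)"

text \<open>
  The space \<open>C\<^sup>k\<close> of the closure of \<open>S\<close>: \<open>f\<close> is \<open>C\<^sup>k\<close> in \<open>S\<close> and all derivatives of order at
  most \<open>k\<close> extend continuously to the closure. Values of \<open>f\<close> off the closure are irrelevant
  here.
\<close>

definition Ck_closure :: "nat \<Rightarrow> (real^3) set \<Rightarrow> (real^3 \<Rightarrow> real^3) \<Rightarrow> bool" where
  "Ck_closure k S f \<longleftrightarrow> Ck_on k f S \<and> continuous_on (closure S) f \<and>
     (\<forall>\<beta>. mi_order \<beta> \<le> k \<longrightarrow>
        (\<exists>g. continuous_on (closure S) g \<and> (\<forall>x\<in>S. g x = mi_deriv \<beta> f x)))"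

definition top_derivs_Holder :: "nat \<Rightarrow> real \<Rightarrow> (real^3) set \<Rightarrow> (real^3 \<Rightarrow> real^3) \<Rightarrow> bool" where
  "top_derivs_Holder k \<alpha> S f \<longleftrightarrow>
     (\<forall>\<beta>. mi_order \<beta> = k \<longrightarrow>
        (\<exists>C. \<forall>x\<in>S. \<forall>y\<in>S. norm (mi_deriv \<beta> f x - mi_deriv \<beta> f y) \<le> C * norm (x - y) powr \<alpha>))"

text \<open>
  A function on the closure of \<open>S\<close> is represented by its extension with value \<open>undefined\<close>
  outside the closure, so that equality in the space is equality of functions on the closure.
  By convention, \<open>C\<^bsup>k,0\<^esup> = C\<^sup>k\<close>.
\<close>

definition Holder_space :: "nat \<Rightarrow> real \<Rightarrow> (real^3) set \<Rightarrow> (real^3 \<Rightarrow> real^3) set" where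
  "Holder_space k \<alpha> S = {f \<in> extensional (closure S).
     Ck_closure k S f \<and> (\<alpha> = 0 \<or> top_derivs_Holder k \<alpha> S f)}"

definition Ck_norm :: "nat \<Rightarrow> (real^3) set \<Rightarrow> (real^3 \<Rightarrow> real^3) \<Rightarrow> real" where
  "Ck_norm k S f = (SUP (\<beta>, x) \<in> {\<beta>. mi_order \<beta> \<le> k} \<times> S. norm (mi_deriv \<beta> f x))"

definition Holder_seminorm :: "nat \<Rightarrow> real \<Rightarrow> (real^3) set \<Rightarrow> (real^3 \<Rightarrow> real^3) \<Rightarrow> real" where
  "Holder_seminorm k \<alpha> S f =
     (SUP (\<beta>, x, y) \<in> {(\<beta>, x, y). mi_order \<beta> = k \<and> x \<in> S \<and> y \<in> S \<and> x \<noteq> y}.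
        norm (mi_deriv \<beta> f x - mi_deriv \<beta> f y) / norm (x - y) powr \<alpha>)"

definition Holder_norm :: "nat \<Rightarrow> real \<Rightarrow> (real^3) set \<Rightarrow> (real^3 \<Rightarrow> real^3) \<Rightarrow> real" where
  "Holder_norm k \<alpha> S f = Ck_norm k S f + (if \<alpha> = 0 then 0 else Holder_seminorm k \<alpha> S f)"

text \<open>
  The metric of the norm. The norm only looks at values in \<open>S\<close>, so the difference needs no
  restriction to the closure. The guard is there because the locale \<^locale>\<open>Metric_space\<close>
  asks for symmetry and nonnegativity off the carrier, where a supremum above may be
  unbounded and hence meaningless.
\<close>

definition Holder_dist :: "nat \<Rightarrow> real \<Rightarrow> (real^3) set \<Rightarrow> (real^3 \<Rightarrow> real^3) \<Rightarrow> (real^3 \<Rightarrow> real^3) \<Rightarrow> real" where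
  "Holder_dist k \<alpha> S f g =
     (if f \<in> Holder_space k \<alpha> S \<and> g \<in> Holder_space k \<alpha> S
      then Holder_norm k \<alpha> S (\<lambda>x. f x - g x) else 0)"

definition Holder_topology :: "nat \<Rightarrow> real \<Rightarrow> (real^3) set \<Rightarrow> (real^3 \<Rightarrow> real^3) topology" where
  "Holder_topology k \<alpha> S = Metric_space.mtopology (Holder_space k \<alpha> S) (Holder_dist k \<alpha> S)"

definition inv_closure :: "(real^3) set \<Rightarrow> (real^3 \<Rightarrow> real^3) \<Rightarrow> real^3 \<Rightarrow> real^3" where
  "inv_closure S \<Phi> = restrict (inv_into (closure S) \<Phi>) (closure S)"

definition Holder_diffeos :: "nat \<Rightarrow> real \<Rightarrow> (real^3) set \<Rightarrow> (real^3 \<Rightarrow> real^3) set" where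
  "Holder_diffeos k \<alpha> S = {\<Phi>. bij_betw \<Phi> (closure S) (closure S) \<and>
     \<Phi> \<in> Holder_space k \<alpha> S \<and> inv_closure S \<Phi> \<in> Holder_space k \<alpha> S}"

definition U_ad :: "nat \<Rightarrow> real \<Rightarrow> real \<Rightarrow> (real^3) set \<Rightarrow> (real^3 \<Rightarrow> real^3) set" where
  "U_ad k \<alpha> K S = {\<Phi> \<in> Holder_diffeos k \<alpha> S.
     Holder_norm k \<alpha> S \<Phi> \<le> K \<and> Holder_norm k \<alpha> S (inv_closure S \<Phi>) \<le> K}"

subsection \<open>The distance is a metric\<close>

lemma hvd_cong:
  assumes "open S" "x \<in> S" "\<And>y. y \<in> S \<Longrightarrow> f y = g y"
    and "((\<lambda>t. f (x + t *\<^sub>R axis i 1 :: real^3)) has_vector_derivative v) (at 0)"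
  shows "((\<lambda>t. g (x + t *\<^sub>R axis i 1)) has_vector_derivative v) (at 0)"
proof -
  have o: "open ((\<lambda>t. x + t *\<^sub>R axis i 1) -` S)"
    by (intro continuous_open_vimage assms continuous_intros)
  show ?thesis
    by (rule has_vector_derivative_transform_within_open[OF assms(4) o]) (use assms in auto)
qed

lemma partial_eqI:
  assumes "((\<lambda>t. f (x + t *\<^sub>R axis i 1)) has_vector_derivative v) (at 0)"
  shows "partial i f x = v"
  unfolding partial_def by (rule vector_derivative_at[OF assms])

lemma partial_cong:
  assumes "open S" "\<And>y. y \<in> S \<Longrightarrow> f y = g y" "x \<in> S"
  shows "partial i f x = partial i g x"
proof -
  have "((\<lambda>t. f (x + t *\<^sub>R axis i 1)) has_vector_derivative v) (at 0) \<longleftrightarrow>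
        ((\<lambda>t. g (x + t *\<^sub>R axis i 1)) has_vector_derivative v) (at 0)" for v
    using hvd_cong[of S x f g i v] hvd_cong[of S x g f i v] assms by auto
  then show ?thesis unfolding partial_def vector_derivative_def by simp
qed

lemma Ck_on_cong:
  assumes "open S" "\<And>y. y \<in> S \<Longrightarrow> f y = g y" "Ck_on k f S"
  shows "Ck_on k g S"
  using assms(2,3)
proof (induction k arbitrary: f g)
  case 0
  then show ?case using continuous_on_cong[of S S f g] by simp
next
  case (Suc k)
  have "continuous_on S g"
    using Suc.prems continuous_on_cong[of S S f g] by simp
  moreover have "(\<lambda>t. g (x + t *\<^sub>R axis i 1)) differentiable (at 0)" if "x \<in> S" for i x
  proof -
    have "(\<lambda>t. f (x + t *\<^sub>R axis i 1)) differentiable (at 0)" using Suc.prems that by auto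
    then obtain v where "((\<lambda>t. f (x + t *\<^sub>R axis i 1)) has_vector_derivative v) (at 0)"
      using vector_derivative_works by blast
    then have "((\<lambda>t. g (x + t *\<^sub>R axis i 1)) has_vector_derivative v) (at 0)"
      using hvd_cong[of S x f g i v] assms(1) Suc.prems that by auto
    then show ?thesis by (rule differentiableI_vector)
  qed
  moreover have "Ck_on k (partial i g) S" for i
  proof (rule Suc.IH)
    show "partial i f y = partial i g y" if "y \<in> S" for y
      by (rule partial_cong[OF assms(1) Suc.prems(1) that])
    show "Ck_on k (partial i f) S" using Suc.prems(2) by simp
  qed
  ultimately show ?case by simp
qed

lemma partial_lin:
  assumes "(\<lambda>t. f (x + t *\<^sub>R axis i 1)) differentiable (at 0)"
    and "(\<lambda>t. g (x + t *\<^sub>R axis i 1)) differentiable (at 0)"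
  shows "(\<lambda>t. a *\<^sub>R f (x + t *\<^sub>R axis i 1) + b *\<^sub>R g (x + t *\<^sub>R axis i 1)) differentiable (at 0)"
    and "partial i (\<lambda>x. a *\<^sub>R f x + b *\<^sub>R g x) x = a *\<^sub>R partial i f x + b *\<^sub>R partial i g x"
proof -
  have h: "((\<lambda>t. a *\<^sub>R f (x + t *\<^sub>R axis i 1) + b *\<^sub>R g (x + t *\<^sub>R axis i 1))
         has_vector_derivative (a *\<^sub>R partial i f x + b *\<^sub>R partial i g x)) (at 0)"
    unfolding partial_def
    using assms[unfolded vector_derivative_works]
    by (intro derivative_intros bounded_linear.has_vector_derivative[OF bounded_linear_scaleR_right])
  show "(\<lambda>t. a *\<^sub>R f (x + t *\<^sub>R axis i 1) + b *\<^sub>R g (x + t *\<^sub>R axis i 1)) differentiable (at 0)"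
    by (rule differentiableI_vector[OF h])
  show "partial i (\<lambda>x. a *\<^sub>R f x + b *\<^sub>R g x) x = a *\<^sub>R partial i f x + b *\<^sub>R partial i g x"
    by (rule partial_eqI[OF h])
qed

lemma Ck_on_lin:
  assumes "open S" "Ck_on k f S" "Ck_on k g S"
  shows "Ck_on k (\<lambda>x. a *\<^sub>R f x + b *\<^sub>R g x) S"
  using assms(2,3)
proof (induction k arbitrary: f g)
  case 0
  then show ?case by (auto intro!: continuous_intros)
next
  case (Suc k)
  have "Ck_on k (partial i (\<lambda>x. a *\<^sub>R f x + b *\<^sub>R g x)) S" for i
  proof (rule Ck_on_cong[OF assms(1)])
    show "Ck_on k (\<lambda>x. a *\<^sub>R partial i f x + b *\<^sub>R partial i g x) S"
      using Suc by auto
    show "a *\<^sub>R partial i f y + b *\<^sub>R partial i g y = partial i (\<lambda>x. a *\<^sub>R f x + b *\<^sub>R g x) y"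
      if "y \<in> S" for y
      using Suc.prems that by (subst partial_lin(2)) auto
  qed
  then show ?case using Suc.prems by (auto intro!: continuous_intros partial_lin(1))
qed

lemma Ck_on_iter: "Ck_on k f S \<Longrightarrow> n \<le> k \<Longrightarrow> Ck_on (k - n) ((partial i ^^ n) f) S"
proof (induction n)
  case 0
  then show ?case by simp
next
  case (Suc n)
  have "Ck_on (Suc (k - Suc n)) ((partial i ^^ n) f) S"
    using Suc by (metis Suc_diff_Suc Suc_leD Suc_le_lessD)
  then show ?case by simp
qed

lemma iter_cong:
  assumes "open S" "\<And>y. y \<in> S \<Longrightarrow> f y = g y"
  shows "x \<in> S \<Longrightarrow> (partial i ^^ n) f x = (partial i ^^ n) g x"
proof (induction n arbitrary: x)
  case 0 then show ?case using assms by simp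
next
  case (Suc n)
  then show ?case using partial_cong[OF assms(1) Suc.IH Suc.prems] by simp
qed

lemma iter_lin:
  assumes "open S" "Ck_on k f S" "Ck_on k g S"
  shows "n \<le> k \<Longrightarrow> x \<in> S \<Longrightarrow> (partial i ^^ n) (\<lambda>x. a *\<^sub>R f x + b *\<^sub>R g x) x
     = a *\<^sub>R (partial i ^^ n) f x + b *\<^sub>R (partial i ^^ n) g x"
proof (induction n arbitrary: x)
  case 0 then show ?case by simp
next
  case (Suc n)
  have d: "Ck_on (Suc (k - Suc n)) ((partial i ^^ n) f) S" "Ck_on (Suc (k - Suc n)) ((partial i ^^ n) g) S"
    using Suc.prems Ck_on_iter[OF assms(2), of n i] Ck_on_iter[OF assms(3), of n i]
    by (metis Suc_diff_Suc Suc_leD Suc_le_lessD)+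
  have "partial i ((partial i ^^ n) (\<lambda>x. a *\<^sub>R f x + b *\<^sub>R g x)) x
      = partial i (\<lambda>x. a *\<^sub>R (partial i ^^ n) f x + b *\<^sub>R (partial i ^^ n) g x) x"
    using Suc by (intro partial_cong[OF assms(1)]) auto
  also have "\<dots> = a *\<^sub>R partial i ((partial i ^^ n) f) x + b *\<^sub>R partial i ((partial i ^^ n) g) x"
    using d Suc.prems by (intro partial_lin(2)) auto
  finally show ?case by simp
qed

lemma mi_deriv_lin:
  assumes "open S" "Ck_on k f S" "Ck_on k g S" "mi_order \<beta> \<le> k" "x \<in> S"
  shows "mi_deriv \<beta> (\<lambda>x. a *\<^sub>R f x + b *\<^sub>R g x) x = a *\<^sub>R mi_deriv \<beta> f x + b *\<^sub>R mi_deriv \<beta> g x"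
proof -
  have le: "\<beta> 1 + \<beta> 2 + \<beta> 3 \<le> k" using assms(4) by (simp add: mi_order_def sum_3)
  let ?h = "\<lambda>x. a *\<^sub>R f x + b *\<^sub>R g x"
  have 1: "(partial 3 ^^ \<beta> 3) ?h y = a *\<^sub>R (partial 3 ^^ \<beta> 3) f y + b *\<^sub>R (partial 3 ^^ \<beta> 3) g y"
    if "y \<in> S" for y
    by (rule iter_lin[OF assms(1-3)]) (use le that in auto)
  have c1: "Ck_on (k - \<beta> 3) ((partial 3 ^^ \<beta> 3) u) S" if "Ck_on k u S" for u
    by (rule Ck_on_iter[OF that]) (use le in auto)
  have 2: "(partial 2 ^^ \<beta> 2) ((partial 3 ^^ \<beta> 3) ?h) y =
      a *\<^sub>R (partial 2 ^^ \<beta> 2) ((partial 3 ^^ \<beta> 3) f) y + b *\<^sub>R (partial 2 ^^ \<beta> 2) ((partial 3 ^^ \<beta> 3) g) y"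
    if "y \<in> S" for y
  proof -
    have "(partial 2 ^^ \<beta> 2) ((partial 3 ^^ \<beta> 3) ?h) y = (partial 2 ^^ \<beta> 2)
        (\<lambda>y. a *\<^sub>R (partial 3 ^^ \<beta> 3) f y + b *\<^sub>R (partial 3 ^^ \<beta> 3) g y) y"
      by (rule iter_cong[OF assms(1) 1 that])
    also have "\<dots> = a *\<^sub>R (partial 2 ^^ \<beta> 2) ((partial 3 ^^ \<beta> 3) f) y + b *\<^sub>R (partial 2 ^^ \<beta> 2) ((partial 3 ^^ \<beta> 3) g) y"
      by (rule iter_lin[OF assms(1) c1[OF assms(2)] c1[OF assms(3)]]) (use le that in auto)
    finally show ?thesis .
  qed
  have c2: "Ck_on (k - \<beta> 3 - \<beta> 2) ((partial 2 ^^ \<beta> 2) ((partial 3 ^^ \<beta> 3) u)) S" if "Ck_on k u S" for u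
    by (rule Ck_on_iter[OF c1[OF that]]) (use le in auto)
  have "mi_deriv \<beta> ?h x = (partial 1 ^^ \<beta> 1) (\<lambda>y. a *\<^sub>R (partial 2 ^^ \<beta> 2) ((partial 3 ^^ \<beta> 3) f) y
       + b *\<^sub>R (partial 2 ^^ \<beta> 2) ((partial 3 ^^ \<beta> 3) g) y) x"
    unfolding mi_deriv_def by (rule iter_cong[OF assms(1) 2 assms(5)])
  also have "\<dots> = a *\<^sub>R mi_deriv \<beta> f x + b *\<^sub>R mi_deriv \<beta> g x"
    unfolding mi_deriv_def
    by (rule iter_lin[OF assms(1) c2[OF assms(2)] c2[OF assms(3)]]) (use le assms(5) in auto)
  finally show ?thesis .
qed

lemma Ck_closure_lin:
  assumes "open S" "Ck_closure k S f" "Ck_closure k S g"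
  shows "Ck_closure k S (\<lambda>x. a *\<^sub>R f x + b *\<^sub>R g x)"
proof -
  have c: "Ck_on k f S" "Ck_on k g S" using assms by (auto simp: Ck_closure_def)
  have "\<exists>h. continuous_on (closure S) h \<and> (\<forall>x\<in>S. h x = mi_deriv \<beta> (\<lambda>x. a *\<^sub>R f x + b *\<^sub>R g x) x)"
    if b: "mi_order \<beta> \<le> k" for \<beta>
  proof -
    obtain u where u: "continuous_on (closure S) u" "\<forall>x\<in>S. u x = mi_deriv \<beta> f x"
      using assms b unfolding Ck_closure_def by blast
    obtain v where v: "continuous_on (closure S) v" "\<forall>x\<in>S. v x = mi_deriv \<beta> g x"
      using assms b unfolding Ck_closure_def by blast
    show ?thesis
      by (rule exI[of _ "\<lambda>x. a *\<^sub>R u x + b *\<^sub>R v x"])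
        (use u v mi_deriv_lin[OF assms(1) c b] in \<open>auto intro!: continuous_intros\<close>)
  qed
  then show ?thesis
    using assms Ck_on_lin[OF assms(1) c] unfolding Ck_closure_def
    by (auto intro!: continuous_intros)
qed

lemma top_derivs_Holder_lin:
  assumes "open S" "Ck_on k f S" "Ck_on k g S" "top_derivs_Holder k \<alpha> S f" "top_derivs_Holder k \<alpha> S g"
  shows "top_derivs_Holder k \<alpha> S (\<lambda>x. a *\<^sub>R f x + b *\<^sub>R g x)"
  unfolding top_derivs_Holder_def
proof (intro allI impI)
  fix \<beta> :: "3 \<Rightarrow> nat" assume b: "mi_order \<beta> = k"
  obtain C where C: "\<forall>x\<in>S. \<forall>y\<in>S. norm (mi_deriv \<beta> f x - mi_deriv \<beta> f y) \<le> C * norm (x - y) powr \<alpha>"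
    using assms b unfolding top_derivs_Holder_def by blast
  obtain D where D: "\<forall>x\<in>S. \<forall>y\<in>S. norm (mi_deriv \<beta> g x - mi_deriv \<beta> g y) \<le> D * norm (x - y) powr \<alpha>"
    using assms b unfolding top_derivs_Holder_def by blast
  have "norm (mi_deriv \<beta> (\<lambda>x. a *\<^sub>R f x + b *\<^sub>R g x) x - mi_deriv \<beta> (\<lambda>x. a *\<^sub>R f x + b *\<^sub>R g x) y)
     \<le> (\<bar>a\<bar> * C + \<bar>b\<bar> * D) * norm (x - y) powr \<alpha>" if xy: "x \<in> S" "y \<in> S" for x y
  proof -
    have "mi_deriv \<beta> (\<lambda>x. a *\<^sub>R f x + b *\<^sub>R g x) x - mi_deriv \<beta> (\<lambda>x. a *\<^sub>R f x + b *\<^sub>R g x) y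
      = a *\<^sub>R (mi_deriv \<beta> f x - mi_deriv \<beta> f y) + b *\<^sub>R (mi_deriv \<beta> g x - mi_deriv \<beta> g y)"
      using mi_deriv_lin[OF assms(1-3)] b xy by (simp add: algebra_simps)
    also have "norm \<dots> \<le> \<bar>a\<bar> * norm (mi_deriv \<beta> f x - mi_deriv \<beta> f y) + \<bar>b\<bar> * norm (mi_deriv \<beta> g x - mi_deriv \<beta> g y)"
      by (rule order_trans[OF norm_triangle_ineq]) simp
    also have "\<dots> \<le> \<bar>a\<bar> * (C * norm (x - y) powr \<alpha>) + \<bar>b\<bar> * (D * norm (x - y) powr \<alpha>)"
      using C D xy by (intro add_mono mult_left_mono) auto
    finally show ?thesis by (simp add: algebra_simps)
  qed
  then show "\<exists>C. \<forall>x\<in>S. \<forall>y\<in>S. norm (mi_deriv \<beta> (\<lambda>x. a *\<^sub>R f x + b *\<^sub>R g x) x -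
      mi_deriv \<beta> (\<lambda>x. a *\<^sub>R f x + b *\<^sub>R g x) y) \<le> C * norm (x - y) powr \<alpha>" by blast
qed

lemma finite_mi: "finite {\<beta>. mi_order \<beta> \<le> k}"
proof (rule finite_subset)
  show "{\<beta>. mi_order \<beta> \<le> k} \<subseteq> (\<Pi>\<^sub>E i\<in>UNIV. {..k})"
  proof safe
    fix \<beta> :: "3 \<Rightarrow> nat" and i assume "mi_order \<beta> \<le> k"
    then show "\<beta> i \<le> k"
      unfolding mi_order_def using member_le_sum[of i UNIV \<beta>] by simp
  qed auto
qed (intro finite_PiE; simp)

lemma mi_zero: "mi_order (\<lambda>_. 0) = 0" "mi_deriv (\<lambda>_. 0) f = f"
  by (auto simp: mi_order_def mi_deriv_def)

lemma Ck_bdd: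
  assumes "bounded S" "Ck_closure k S f"
  shows "bdd_above ((\<lambda>(\<beta>, x). norm (mi_deriv \<beta> f x)) ` ({\<beta>. mi_order \<beta> \<le> k} \<times> S))"
proof -
  have "\<exists>B. \<forall>x\<in>S. norm (mi_deriv \<beta> f x) \<le> B" if b: "mi_order \<beta> \<le> k" for \<beta>
  proof -
    obtain u where u: "continuous_on (closure S) u" "\<forall>x\<in>S. u x = mi_deriv \<beta> f x"
      using assms b unfolding Ck_closure_def by blast
    have "bounded (u ` closure S)"
      using u assms(1) by (intro compact_imp_bounded compact_continuous_image) (auto simp: compact_closure)
    then obtain B where "\<forall>x\<in>closure S. norm (u x) \<le> B" by (auto simp: bounded_iff)
    then show ?thesis using u(2) closure_subset by (metis subsetD)
  qed
  then obtain B where B: "\<And>\<beta> x. mi_order \<beta> \<le> k \<Longrightarrow> x \<in> S \<Longrightarrow> norm (mi_deriv \<beta> f x) \<le> B \<beta>" by metis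
  show ?thesis
  proof (rule bdd_aboveI2[where M = "Max (B ` {\<beta>. mi_order \<beta> \<le> k})"], clarsimp)
    fix \<beta> x assume h: "mi_order \<beta> \<le> k" "x \<in> S"
    have "B \<beta> \<le> Max (B ` {\<beta>. mi_order \<beta> \<le> k})" using h finite_mi by (intro Max_ge) auto
    then show "norm (mi_deriv \<beta> f x) \<le> Max (B ` {\<beta>. mi_order \<beta> \<le> k})" using B[OF h] by linarith
  qed
qed

lemma Holder_bdd:
  assumes "top_derivs_Holder k \<alpha> S f"
  shows "bdd_above ((\<lambda>(\<beta>, x, y). norm (mi_deriv \<beta> f x - mi_deriv \<beta> f y) / norm (x - y) powr \<alpha>) `
     {(\<beta>, x, y). mi_order \<beta> = k \<and> x \<in> S \<and> y \<in> S \<and> x \<noteq> y})"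
proof -
  obtain B where B: "\<And>\<beta> x y. mi_order \<beta> = k \<Longrightarrow> x \<in> S \<Longrightarrow> y \<in> S \<Longrightarrow>
      norm (mi_deriv \<beta> f x - mi_deriv \<beta> f y) \<le> B \<beta> * norm (x - y) powr \<alpha>"
    using assms unfolding top_derivs_Holder_def by metis
  show ?thesis
  proof (rule bdd_aboveI2[where M = "Max (B ` {\<beta>. mi_order \<beta> \<le> k})"], clarsimp)
    fix \<beta> x y assume h: "k = mi_order \<beta>" "x \<in> S" "y \<in> S" "x \<noteq> y"
    have "B \<beta> \<le> Max (B ` {\<beta>. mi_order \<beta> \<le> k})" using h finite_mi by (intro Max_ge) auto
    moreover have "norm (mi_deriv \<beta> f x - mi_deriv \<beta> f y) / norm (x - y) powr \<alpha> \<le> B \<beta>"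
      using B[of \<beta> x y] h by (simp add: divide_le_eq)
    ultimately show "norm (mi_deriv \<beta> f x - mi_deriv \<beta> f y) / norm (x - y) powr \<alpha>
        \<le> Max (B ` {\<beta>'. mi_order \<beta>' \<le> mi_order \<beta>})" using h by simp
  qed
qed

lemma exists_mi: "\<exists>\<beta>. mi_order \<beta> = k"
  by (rule exI[of _ "\<lambda>i. if i = 1 then k else 0"]) (simp add: mi_order_def)

lemma open_two_points:
  fixes S :: "(real^3) set"
  assumes "open S" "S \<noteq> {}"
  shows "\<exists>x\<in>S. \<exists>y\<in>S. x \<noteq> y"
proof -
  from assms(2) obtain x where x: "x \<in> S" by auto
  then have "\<not> open {x}" by (metis not_open_singleton)
  then have "S \<noteq> {x}" using assms(1) by auto
  with x show ?thesis by blast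
qed

definition Holder_reg :: "nat \<Rightarrow> real \<Rightarrow> (real^3) set \<Rightarrow> (real^3 \<Rightarrow> real^3) \<Rightarrow> bool" where
  "Holder_reg k \<alpha> S f \<longleftrightarrow> Ck_closure k S f \<and> (\<alpha> = 0 \<or> top_derivs_Holder k \<alpha> S f)"

lemma Holder_reg_lin:
  "open S \<Longrightarrow> Holder_reg k \<alpha> S f \<Longrightarrow> Holder_reg k \<alpha> S g \<Longrightarrow> Holder_reg k \<alpha> S (\<lambda>x. a *\<^sub>R f x + b *\<^sub>R g x)"
  using top_derivs_Holder_lin[of S k f g \<alpha> a b] Ck_closure_lin[of S k f g a b]
  by (auto simp: Holder_reg_def Ck_closure_def)

lemma norm_le_Ck_norm:
  assumes "bounded S" "Ck_closure k S f" "mi_order \<beta> \<le> k" "x \<in> S"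
  shows "norm (mi_deriv \<beta> f x) \<le> Ck_norm k S f"
  unfolding Ck_norm_def
  using cSUP_upper[OF _ Ck_bdd[OF assms(1,2)], of "(\<beta>, x)"] assms by simp

lemma quotient_le_Holder_seminorm:
  assumes "top_derivs_Holder k \<alpha> S f" "mi_order \<beta> = k" "x \<in> S" "y \<in> S" "x \<noteq> y"
  shows "norm (mi_deriv \<beta> f x - mi_deriv \<beta> f y) / norm (x - y) powr \<alpha> \<le> Holder_seminorm k \<alpha> S f"
  unfolding Holder_seminorm_def
  using cSUP_upper[OF _ Holder_bdd[OF assms(1)], of "(\<beta>, x, y)"] assms by simp

lemma Ck_norm_le:
  assumes "S \<noteq> {}" "\<And>\<beta> x. mi_order \<beta> \<le> k \<Longrightarrow> x \<in> S \<Longrightarrow> norm (mi_deriv \<beta> f x) \<le> B"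
  shows "Ck_norm k S f \<le> B"
proof -
  have "(\<lambda>_. 0) \<in> {\<beta>. mi_order \<beta> \<le> k}" using mi_zero(1) by simp
  then show ?thesis unfolding Ck_norm_def by (intro cSUP_least) (use assms in auto)
qed

lemma Holder_seminorm_le:
  assumes "open S" "S \<noteq> {}"
    "\<And>\<beta> x y. mi_order \<beta> = k \<Longrightarrow> x \<in> S \<Longrightarrow> y \<in> S \<Longrightarrow> x \<noteq> y \<Longrightarrow>
       norm (mi_deriv \<beta> f x - mi_deriv \<beta> f y) / norm (x - y) powr \<alpha> \<le> B"
  shows "Holder_seminorm k \<alpha> S f \<le> B"
proof -
  have "{(\<beta>, x, y). mi_order \<beta> = k \<and> x \<in> S \<and> y \<in> S \<and> x \<noteq> y} \<noteq> {}"
    using open_two_points[OF assms(1,2)] exists_mi[of k] by auto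
  then show ?thesis unfolding Holder_seminorm_def by (intro cSUP_least) (use assms in auto)
qed

lemma Ck_norm_nonneg: "bounded S \<Longrightarrow> S \<noteq> {} \<Longrightarrow> Ck_closure k S f \<Longrightarrow> 0 \<le> Ck_norm k S f"
proof -
  assume a: "bounded S" "S \<noteq> {}" "Ck_closure k S f"
  then obtain x where "x \<in> S" by auto
  then have "norm (mi_deriv (\<lambda>_. 0) f x) \<le> Ck_norm k S f"
    using a mi_zero(1) by (intro norm_le_Ck_norm) auto
  then show ?thesis using norm_ge_zero order_trans by blast
qed

lemma Holder_seminorm_nonneg:
  "open S \<Longrightarrow> S \<noteq> {} \<Longrightarrow> top_derivs_Holder k \<alpha> S f \<Longrightarrow> 0 \<le> Holder_seminorm k \<alpha> S f"
proof -
  assume a: "open S" "S \<noteq> {}" "top_derivs_Holder k \<alpha> S f"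
  then obtain x y where xy: "x \<in> S" "y \<in> S" "x \<noteq> y" using open_two_points by blast
  obtain \<beta> where "mi_order \<beta> = k" using exists_mi by blast
  then have "norm (mi_deriv \<beta> f x - mi_deriv \<beta> f y) / norm (x - y) powr \<alpha> \<le> Holder_seminorm k \<alpha> S f"
    using a xy by (intro quotient_le_Holder_seminorm) auto
  then show ?thesis by (rule order_trans[rotated]) simp
qed

lemma Holder_norm_lin_le:
  assumes S: "open S" "bounded S" "S \<noteq> {}" and f: "Holder_reg k \<alpha> S f" and g: "Holder_reg k \<alpha> S g"
  shows "Holder_norm k \<alpha> S (\<lambda>x. a *\<^sub>R f x + b *\<^sub>R g x)
     \<le> \<bar>a\<bar> * Holder_norm k \<alpha> S f + \<bar>b\<bar> * Holder_norm k \<alpha> S g"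
proof -
  let ?h = "\<lambda>x. a *\<^sub>R f x + b *\<^sub>R g x"
  have c: "Ck_on k f S" "Ck_on k g S" using f g by (auto simp: Holder_reg_def Ck_closure_def)
  have cc: "Ck_closure k S f" "Ck_closure k S g" using f g by (auto simp: Holder_reg_def)
  have 1: "Ck_norm k S ?h \<le> \<bar>a\<bar> * Ck_norm k S f + \<bar>b\<bar> * Ck_norm k S g"
  proof (rule Ck_norm_le[OF S(3)])
    fix \<beta> x assume b: "mi_order \<beta> \<le> k" "x \<in> S"
    have "norm (mi_deriv \<beta> ?h x) \<le> \<bar>a\<bar> * norm (mi_deriv \<beta> f x) + \<bar>b\<bar> * norm (mi_deriv \<beta> g x)"
      unfolding mi_deriv_lin[OF S(1) c b] by (rule order_trans[OF norm_triangle_ineq]) simp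
    also have "\<dots> \<le> \<bar>a\<bar> * Ck_norm k S f + \<bar>b\<bar> * Ck_norm k S g"
      using cc b S by (intro add_mono mult_left_mono norm_le_Ck_norm) auto
    finally show "norm (mi_deriv \<beta> ?h x) \<le> \<bar>a\<bar> * Ck_norm k S f + \<bar>b\<bar> * Ck_norm k S g" .
  qed
  have 2: "Holder_seminorm k \<alpha> S ?h \<le> \<bar>a\<bar> * Holder_seminorm k \<alpha> S f + \<bar>b\<bar> * Holder_seminorm k \<alpha> S g"
    if "\<alpha> \<noteq> 0"
  proof (rule Holder_seminorm_le[OF S(1,3)])
    have t: "top_derivs_Holder k \<alpha> S f" "top_derivs_Holder k \<alpha> S g"
      using f g that by (auto simp: Holder_reg_def)
    fix \<beta> x y assume b: "mi_order \<beta> = k" and xy: "x \<in> S" "y \<in> S" "x \<noteq> y"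
    have "mi_deriv \<beta> ?h x - mi_deriv \<beta> ?h y
      = a *\<^sub>R (mi_deriv \<beta> f x - mi_deriv \<beta> f y) + b *\<^sub>R (mi_deriv \<beta> g x - mi_deriv \<beta> g y)"
      using mi_deriv_lin[OF S(1) c] b xy by (simp add: algebra_simps)
    then have "norm (mi_deriv \<beta> ?h x - mi_deriv \<beta> ?h y)
        \<le> \<bar>a\<bar> * norm (mi_deriv \<beta> f x - mi_deriv \<beta> f y) + \<bar>b\<bar> * norm (mi_deriv \<beta> g x - mi_deriv \<beta> g y)"
      using norm_triangle_ineq by (metis norm_scaleR)
    then have "norm (mi_deriv \<beta> ?h x - mi_deriv \<beta> ?h y) / norm (x - y) powr \<alpha>
        \<le> (\<bar>a\<bar> * norm (mi_deriv \<beta> f x - mi_deriv \<beta> f y) + \<bar>b\<bar> * norm (mi_deriv \<beta> g x - mi_deriv \<beta> g y))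
          / norm (x - y) powr \<alpha>"
      by (rule divide_right_mono) simp
    also have "\<dots> = \<bar>a\<bar> * (norm (mi_deriv \<beta> f x - mi_deriv \<beta> f y) / norm (x - y) powr \<alpha>)
        + \<bar>b\<bar> * (norm (mi_deriv \<beta> g x - mi_deriv \<beta> g y) / norm (x - y) powr \<alpha>)"
      by (simp add: add_divide_distrib)
    also have "\<dots> \<le> \<bar>a\<bar> * Holder_seminorm k \<alpha> S f + \<bar>b\<bar> * Holder_seminorm k \<alpha> S g"
      using t b xy by (intro add_mono mult_left_mono quotient_le_Holder_seminorm) auto
    finally show "norm (mi_deriv \<beta> ?h x - mi_deriv \<beta> ?h y) / norm (x - y) powr \<alpha>
        \<le> \<bar>a\<bar> * Holder_seminorm k \<alpha> S f + \<bar>b\<bar> * Holder_seminorm k \<alpha> S g" .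
  qed
  show ?thesis
    using 1 2 by (auto simp: Holder_norm_def algebra_simps)
qed

lemma Ck_norm_le_Holder_norm:
  assumes "open S" "S \<noteq> {}" "Holder_reg k \<alpha> S f"
  shows "Ck_norm k S f \<le> Holder_norm k \<alpha> S f"
  using assms Holder_seminorm_nonneg[OF assms(1,2), of k \<alpha> f]
  by (auto simp: Holder_norm_def Holder_reg_def)

lemma Holder_norm_zero: "open S \<Longrightarrow> bounded S \<Longrightarrow> S \<noteq> {} \<Longrightarrow> Holder_reg k \<alpha> S f \<Longrightarrow> Holder_norm k \<alpha> S (\<lambda>x. f x - f x) \<le> 0"
  using Holder_norm_lin_le[of S k \<alpha> f f 0 0] by simp

theorem Metric_space_Holder:
  assumes S: "open S" "bounded S" "S \<noteq> {}"
  shows "Metric_space (Holder_space k \<alpha> S) (Holder_dist k \<alpha> S)"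
proof -
  let ?M = "Holder_space k \<alpha> S" and ?d = "Holder_dist k \<alpha> S"
  have reg: "Holder_reg k \<alpha> S f" if "f \<in> ?M" for f
    using that by (auto simp: Holder_space_def Holder_reg_def)
  have regd: "Holder_reg k \<alpha> S (\<lambda>x. f x - g x)" if "f \<in> ?M" "g \<in> ?M" for f g
    using Holder_reg_lin[OF S(1) reg[OF that(1)] reg[OF that(2)], of 1 "-1"] by simp
  have nn: "0 \<le> Holder_norm k \<alpha> S f" if "Holder_reg k \<alpha> S f" for f
    using order_trans[OF Ck_norm_nonneg[OF S(2,3)] Ck_norm_le_Holder_norm[OF S(1,3) that]] that
    by (simp add: Holder_reg_def)
  have sym: "?d f g \<le> ?d g f" for f g
  proof (cases "f \<in> ?M \<and> g \<in> ?M")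
    case True
    then show ?thesis
      using Holder_norm_lin_le[OF S regd[of g f] regd[of g f], of "-1" 0] by (simp add: Holder_dist_def)
  qed (auto simp: Holder_dist_def)
  show ?thesis
  proof
    show "0 \<le> ?d f g" for f g using nn regd by (auto simp: Holder_dist_def)
    show "?d f g = ?d g f" for f g using sym[of f g] sym[of g f] by simp
    show "?d f h \<le> ?d f g + ?d g h" if "f \<in> ?M" "g \<in> ?M" "h \<in> ?M" for f g h
      using Holder_norm_lin_le[OF S regd[OF that(1,2)] regd[OF that(2,3)], of 1 1] that
      by (simp add: Holder_dist_def)
    show "?d f g = 0 \<longleftrightarrow> f = g" if M: "f \<in> ?M" "g \<in> ?M" for f g
    proof
      assume "f = g"
      then show "?d f g = 0"
        using Holder_norm_zero[OF S reg[OF M(2)]] nn[OF regd[OF M(2) M(2)]] M by (simp add: Holder_dist_def)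
    next
      assume "?d f g = 0"
      then have n0: "Ck_norm k S (\<lambda>x. f x - g x) \<le> 0"
        using Ck_norm_le_Holder_norm[OF S(1,3) regd[OF M]] M by (simp add: Holder_dist_def)
      have "f x = g x" if "x \<in> S" for x
      proof -
        have "norm (f x - g x) \<le> 0"
          using norm_le_Ck_norm[OF S(2), of k "\<lambda>x. f x - g x" "\<lambda>_. 0" x, unfolded mi_zero] n0 regd[OF M] that
          unfolding Holder_reg_def by linarith
        then show ?thesis by simp
      qed
      moreover have "continuous_on (closure S) (\<lambda>x. f x - g x)"
        using regd[OF M] by (simp add: Holder_reg_def Ck_closure_def)
      ultimately have "f x - g x = 0" if "x \<in> closure S" for x
        using continuous_constant_on_closure[of S "\<lambda>x. f x - g x" 0 x] that by simp
      then show "f = g"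
        using M by (intro extensionalityI[of _ "closure S"]) (auto simp: Holder_space_def)
    qed
  qed
qed

end

(* A sequence in U_ad is bounded in C^{k,alpha}, so every derivative of order at most k has a uniform
   modulus of continuity: Hoelder at order k, and Lipschitz below, since two points of the ball are
   joined inside the ball by an axis-parallel path of comparable length. Arzela-Ascoli gives a
   subsequence along which all these derivatives converge uniformly, both for the maps and for their
   inverses; the limits are again derivatives of the limit map, the bound K is closed under pointwise
   limits, and the two limit maps are mutually inverse. Interpolating between the C^{k,alpha} bound
   and uniform convergence yields convergence in C^{k,alpha'}. *)
theory Submission
  imports Defs "HOL-Complex_Analysis.Great_Picard"
begin

text \<open>\<open>Ck_on\<close> supplies one-variable derivatives along the coordinate axes and
  nothing else. No total derivative in three variables is ever formed, so every estimate has to move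
  parallel to an axis. A second obstacle is that \<open>mi_deriv\<close> fixes one order of
  differentiation: a further partial of a multi-index derivative is again a multi-index derivative
  only by Schwarz's theorem, proved here for vector-valued maps. Both the Lipschitz bounds below
  order k and the identification of the limits rest on it. Third, derivatives live on the open ball
  while Arzela-Ascoli wants a compact set, so it is applied to their continuous extensions to the
  closed ball. Finally, a uniform limit of bijections may fail to be injective; the bound on the
  inverses is what rules this out. The strict inequality \<alpha>' < \<alpha> leaves a positive
  power 1 - \<alpha>'/\<alpha> of the sup distance in the interpolation.\<close>

section \<open>Derivatives along axes and symmetry of mixed partials\<close>

lemma vector_mean_value_bound:
  fixes g :: "real \<Rightarrow> 'a::real_normed_vector"
  assumes "\<And>s. s \<in> closed_segment 0 h \<Longrightarrow> (g has_vector_derivative g' s) (at s)"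
    and "\<And>s. s \<in> closed_segment 0 h \<Longrightarrow> norm (g' s - A) \<le> C"
  shows "norm (g h - g 0 - h *\<^sub>R A) \<le> C * \<bar>h\<bar>"
proof -
  have "norm ((g h - h *\<^sub>R A) - (g 0 - 0 *\<^sub>R A)) \<le> C * norm (h - 0)"
  \<comment> \<open>The mean value inequality is applied to \<open>g s - s *\<^sub>R A\<close>,
    whose derivative is \<open>g' s - A\<close>. The closed segment also covers negative
    \<open>h\<close>.\<close>
  proof (rule differentiable_bound[where S = "closed_segment 0 h" and f' = "\<lambda>s u. u *\<^sub>R (g' s - A)"])
    fix s assume s: "s \<in> closed_segment 0 h"
    have "((\<lambda>s. g s - s *\<^sub>R A) has_vector_derivative (g' s - 1 *\<^sub>R A)) (at s within closed_segment 0 h)"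
      by (intro derivative_intros has_vector_derivative_at_within[OF assms(1)[OF s]])
         (auto intro!: derivative_eq_intros)
    then show "((\<lambda>s. g s - s *\<^sub>R A) has_derivative (\<lambda>u. u *\<^sub>R (g' s - A))) (at s within closed_segment 0 h)"
      by (simp add: has_vector_derivative_def)
    show "onorm (\<lambda>u. u *\<^sub>R (g' s - A)) \<le> C"
      by (rule onorm_le) (use assms(2)[OF s] in \<open>simp add: mult.commute[of C] mult_left_mono\<close>)
  qed auto
  then show ?thesis by (simp add: algebra_simps)
qed

text \<open>\<open>Ck_on\<close> speaks of differentiability at parameter 0 of a line only. Shifting
  the base point along the line gives it at every parameter, as mean value arguments
  require.\<close>

lemma Ck_on_has_vector_derivative:
  assumes "Ck_on (Suc k) f S" "x + s *\<^sub>R axis i 1 \<in> S"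
  shows "((\<lambda>t. f (x + t *\<^sub>R axis i 1)) has_vector_derivative partial i f (x + s *\<^sub>R axis i 1)) (at s)"
proof -
  have "(\<lambda>t. f ((x + s *\<^sub>R axis i 1) + t *\<^sub>R axis i 1)) differentiable (at 0)"
    using assms by auto
  then have "((\<lambda>t. f ((x + s *\<^sub>R axis i 1) + t *\<^sub>R axis i 1)) has_vector_derivative
      partial i f (x + s *\<^sub>R axis i 1)) (at (s + (-s)))"
    by (simp add: vector_derivative_works partial_def)
  moreover have "((\<lambda>t. t + (-s)) has_vector_derivative 1) (at s)"
    by (auto intro!: derivative_eq_intros)
  ultimately have "(((\<lambda>t. f ((x + s *\<^sub>R axis i 1) + t *\<^sub>R axis i 1)) \<circ> (\<lambda>t. t + (-s))) has_vector_derivative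
      1 *\<^sub>R partial i f (x + s *\<^sub>R axis i 1)) (at s)"
    by (intro vector_diff_chain_at)
  moreover have "(\<lambda>t. f ((x + s *\<^sub>R axis i 1) + t *\<^sub>R axis i 1)) \<circ> (\<lambda>t. t + (-s)) = (\<lambda>t. f (x + t *\<^sub>R axis i 1))"
    by (auto simp: fun_eq_iff algebra_simps)
  ultimately show ?thesis by simp
qed

lemma Ck_on_antimono: "Ck_on k f S \<Longrightarrow> l \<le> k \<Longrightarrow> Ck_on l f S"
proof (induction k arbitrary: l f)
  case (Suc k)
  then show ?case by (cases l) auto
qed simp

text \<open>Two mean value estimates: one in direction j for \<open>partial i f\<close>, then one in
  direction i for the increment of \<open>f\<close> over the step t. Both compare with the single
  vector \<open>partial j (partial i f) x\<close>, to which the mixed partial stays close near x by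
  continuity.\<close>

lemma second_difference_bound:
  assumes "open S" "x \<in> S" "Ck_on 2 f S" "\<epsilon> > 0"
  shows "\<exists>\<delta>>0. \<forall>s t. \<bar>s\<bar> < \<delta> \<longrightarrow> \<bar>t\<bar> < \<delta> \<longrightarrow>
    norm (f (x + t *\<^sub>R axis j 1 + s *\<^sub>R axis i 1) - f (x + s *\<^sub>R axis i 1) - f (x + t *\<^sub>R axis j 1) + f x
      - (s * t) *\<^sub>R partial j (partial i f) x) \<le> \<epsilon> * \<bar>s\<bar> * \<bar>t\<bar>"
proof -
  let ?A = "partial j (partial i f) x"
  have C2: "Ck_on (Suc (Suc 0)) f S" using assms(3) by (simp only: numeral_2_eq_2)
  then have "continuous_on S (partial j (partial i f))" by simp
  then obtain d1 where d1: "d1 > 0" "\<And>y. y \<in> S \<Longrightarrow> dist y x < d1 \<Longrightarrow> dist (partial j (partial i f) y) ?A < \<epsilon>"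
    using assms(2,4) unfolding continuous_on_iff by metis
  obtain d2 where d2: "d2 > 0" "ball x d2 \<subseteq> S" using assms(1,2) open_contains_ball by blast
  \<comment> \<open>Half the minimum, since a step in each of the two directions may add up.\<close>
  define d where "d = min d1 d2 / 2"
  have near: "x + t *\<^sub>R axis j 1 + s *\<^sub>R axis i 1 \<in> S \<and>
      norm (partial j (partial i f) (x + t *\<^sub>R axis j 1 + s *\<^sub>R axis i 1) - ?A) \<le> \<epsilon>"
    if "\<bar>s\<bar> < d" "\<bar>t\<bar> < d" for s t
  proof -
    have "norm (t *\<^sub>R axis j 1 + s *\<^sub>R axis i (1::real)) \<le> \<bar>t\<bar> + \<bar>s\<bar>"
      by (rule order_trans[OF norm_triangle_ineq]) simp
    also have "\<dots> < min d1 d2" using that unfolding d_def by linarith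
    finally have "dist (x + t *\<^sub>R axis j 1 + s *\<^sub>R axis i 1) x < min d1 d2"
      by (simp add: dist_norm add.assoc)
    then have d: "dist (x + t *\<^sub>R axis j 1 + s *\<^sub>R axis i 1) x < d1" "dist x (x + t *\<^sub>R axis j 1 + s *\<^sub>R axis i 1) < d2"
      by (auto simp: dist_commute)
    then have S: "x + t *\<^sub>R axis j 1 + s *\<^sub>R axis i 1 \<in> S" using d2 by auto
    show ?thesis using d1(2)[OF S d(1)] S by (simp add: dist_norm)
  qed
  have "norm (f (x + t *\<^sub>R axis j 1 + s *\<^sub>R axis i 1) - f (x + s *\<^sub>R axis i 1) - f (x + t *\<^sub>R axis j 1) + f x
      - (s * t) *\<^sub>R ?A) \<le> \<epsilon> * \<bar>s\<bar> * \<bar>t\<bar>" if s: "\<bar>s\<bar> < d" and t: "\<bar>t\<bar> < d" for s t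
  proof -
    have d0: "0 < d" using d1 d2 by (simp add: d_def)
    have seg: "\<bar>u\<bar> < d" if "u \<in> closed_segment 0 v" "\<bar>v\<bar> < d" for u v :: real
      using that by (auto simp: closed_segment_eq_real_ivl split: if_splits)
    have in1: "norm (partial i f (x + t *\<^sub>R axis j 1 + s' *\<^sub>R axis i 1) - partial i f (x + s' *\<^sub>R axis i 1)
        - t *\<^sub>R ?A) \<le> \<epsilon> * \<bar>t\<bar>" if s': "\<bar>s'\<bar> < d" for s'
    proof -
      have "norm (partial i f ((x + s' *\<^sub>R axis i 1) + t *\<^sub>R axis j 1)
          - partial i f ((x + s' *\<^sub>R axis i 1) + 0 *\<^sub>R axis j 1) - t *\<^sub>R ?A) \<le> \<epsilon> * \<bar>t\<bar>"
      proof (rule vector_mean_value_bound[where g = "\<lambda>\<tau>. partial i f ((x + s' *\<^sub>R axis i 1) + \<tau> *\<^sub>R axis j 1)"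
            and g' = "\<lambda>\<tau>. partial j (partial i f) ((x + s' *\<^sub>R axis i 1) + \<tau> *\<^sub>R axis j 1)"])
        fix \<tau> assume "\<tau> \<in> closed_segment 0 t"
        then have "\<bar>\<tau>\<bar> < d" using seg t by blast
        note n = near[OF s' this, unfolded add.assoc add.commute[of "\<tau> *\<^sub>R _" "s' *\<^sub>R _"], folded add.assoc]
        show "norm (partial j (partial i f) (x + s' *\<^sub>R axis i 1 + \<tau> *\<^sub>R axis j 1) - ?A) \<le> \<epsilon>"
          using n by simp
        show "((\<lambda>\<tau>. partial i f (x + s' *\<^sub>R axis i 1 + \<tau> *\<^sub>R axis j 1)) has_vector_derivative
             partial j (partial i f) (x + s' *\<^sub>R axis i 1 + \<tau> *\<^sub>R axis j 1)) (at \<tau>)"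
          by (rule Ck_on_has_vector_derivative[where S = S and k = 0]) (use C2 n in auto)
      qed
      then show ?thesis by (simp add: algebra_simps)
    qed
    have "norm ((f (x + t *\<^sub>R axis j 1 + s *\<^sub>R axis i 1) - f (x + s *\<^sub>R axis i 1))
        - (f (x + t *\<^sub>R axis j 1 + 0 *\<^sub>R axis i 1) - f (x + 0 *\<^sub>R axis i 1)) - s *\<^sub>R (t *\<^sub>R ?A)) \<le> (\<epsilon> * \<bar>t\<bar>) * \<bar>s\<bar>"
    proof (rule vector_mean_value_bound[where g = "\<lambda>s. f (x + t *\<^sub>R axis j 1 + s *\<^sub>R axis i 1) - f (x + s *\<^sub>R axis i 1)"
            and g' = "\<lambda>s. partial i f (x + t *\<^sub>R axis j 1 + s *\<^sub>R axis i 1) - partial i f (x + s *\<^sub>R axis i 1)"])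
      fix \<sigma> assume "\<sigma> \<in> closed_segment 0 s"
      then have \<sigma>: "\<bar>\<sigma>\<bar> < d" using seg s by blast
      show "norm (partial i f (x + t *\<^sub>R axis j 1 + \<sigma> *\<^sub>R axis i 1) - partial i f (x + \<sigma> *\<^sub>R axis i 1)
        - t *\<^sub>R ?A) \<le> \<epsilon> * \<bar>t\<bar>" by (rule in1[OF \<sigma>])
      show "((\<lambda>\<sigma>. f (x + t *\<^sub>R axis j 1 + \<sigma> *\<^sub>R axis i 1) - f (x + \<sigma> *\<^sub>R axis i 1)) has_vector_derivative
         partial i f (x + t *\<^sub>R axis j 1 + \<sigma> *\<^sub>R axis i 1) - partial i f (x + \<sigma> *\<^sub>R axis i 1)) (at \<sigma>)"
        using near[OF \<sigma> t] near[OF \<sigma>, of 0] d0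
        by (intro has_vector_derivative_diff Ck_on_has_vector_derivative[OF C2]) auto
    qed
    then show ?thesis by (simp add: algebra_simps)
  qed
  moreover have "d > 0" using d1 d2 by (simp add: d_def)
  ultimately show ?thesis by blast
qed

text \<open>With equal steps s the mixed second difference does not change when i and j are swapped,
  so it approximates s^2 times either mixed partial. Dividing by s^2 bounds their difference by an
  arbitrary e.\<close>

lemma partial_commute:
  assumes "open S" "x \<in> S" "Ck_on 2 f S"
  shows "partial i (partial j f) x = partial j (partial i f) x"
proof -
  let ?A = "partial j (partial i f) x" and ?B = "partial i (partial j f) x"
  have "norm (?A - ?B) \<le> 0 + e" if "e > 0" for e
  proof -
    have e2: "e / 2 > 0" using that by simp
    obtain d1 where d1: "d1 > 0" "\<forall>s t. \<bar>s\<bar> < d1 \<longrightarrow> \<bar>t\<bar> < d1 \<longrightarrow>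
      norm (f (x + t *\<^sub>R axis j 1 + s *\<^sub>R axis i 1) - f (x + s *\<^sub>R axis i 1) - f (x + t *\<^sub>R axis j 1) + f x
      - (s * t) *\<^sub>R ?A) \<le> e / 2 * \<bar>s\<bar> * \<bar>t\<bar>"
      using second_difference_bound[OF assms e2, of j i] by blast
    obtain d2 where d2: "d2 > 0" "\<forall>s t. \<bar>s\<bar> < d2 \<longrightarrow> \<bar>t\<bar> < d2 \<longrightarrow>
      norm (f (x + t *\<^sub>R axis i 1 + s *\<^sub>R axis j 1) - f (x + s *\<^sub>R axis j 1) - f (x + t *\<^sub>R axis i 1) + f x
      - (s * t) *\<^sub>R ?B) \<le> e / 2 * \<bar>s\<bar> * \<bar>t\<bar>"
      using second_difference_bound[OF assms e2, of i j] by blast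
    define s where "s = min d1 d2 / 2"
    have s: "s > 0" "\<bar>s\<bar> < d1" "\<bar>s\<bar> < d2" using d1 d2 by (auto simp: s_def)
    let ?D = "f (x + s *\<^sub>R axis j 1 + s *\<^sub>R axis i 1) - f (x + s *\<^sub>R axis i 1) - f (x + s *\<^sub>R axis j 1) + f x"
    have D: "f (x + s *\<^sub>R axis i 1 + s *\<^sub>R axis j 1) - f (x + s *\<^sub>R axis j 1) - f (x + s *\<^sub>R axis i 1) + f x = ?D"
      by (simp add: algebra_simps)
    have "norm (?D - (s * s) *\<^sub>R ?A) \<le> e / 2 * s * s" "norm (?D - (s * s) *\<^sub>R ?B) \<le> e / 2 * s * s"
      using d1(2)[rule_format, OF s(2,2)] d2(2)[rule_format, OF s(3,3)] s(1) unfolding D by auto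
    then have "norm ((?D - (s * s) *\<^sub>R ?B) - (?D - (s * s) *\<^sub>R ?A)) \<le> e / 2 * s * s + e / 2 * s * s"
      using norm_triangle_ineq4[of "?D - (s * s) *\<^sub>R ?B" "?D - (s * s) *\<^sub>R ?A"] by linarith
    moreover have "(?D - (s * s) *\<^sub>R ?B) - (?D - (s * s) *\<^sub>R ?A) = (s * s) *\<^sub>R (?A - ?B)"
      by (simp add: algebra_simps)
    ultimately have "norm ((s * s) *\<^sub>R (?A - ?B)) \<le> (s * s) * e"
      by (simp only: algebra_simps) simp
    then have "(s * s) * norm (?A - ?B) \<le> (s * s) * e"
      by (simp only: norm_scaleR) (use s(1) in simp)
    then show ?thesis using s(1) by simp
  qed
  then have "norm (?A - ?B) \<le> 0" by (rule field_le_epsilon)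
  then show ?thesis by simp
qed

lemma partial_iter_commute:
  assumes "open S"
  shows "Ck_on (Suc n) f S \<Longrightarrow> x \<in> S \<Longrightarrow> partial i ((partial j ^^ n) f) x = (partial j ^^ n) (partial i f) x"
proof (induction n arbitrary: x)
  case (Suc n)
  have C: "Ck_on (Suc n) f S" by (rule Ck_on_antimono[OF Suc.prems(1)]) simp
  have "Ck_on 2 ((partial j ^^ n) f) S"
    using Ck_on_iter[OF Suc.prems(1), of n j] by (simp add: numeral_2_eq_2)
  then have "partial i (partial j ((partial j ^^ n) f)) x = partial j (partial i ((partial j ^^ n) f)) x"
    by (rule partial_commute[OF assms Suc.prems(2)])
  also have "\<dots> = partial j ((partial j ^^ n) (partial i f)) x"
    by (rule partial_cong[OF assms _ Suc.prems(2)]) (rule Suc.IH[OF C])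
  finally show ?case by simp
qed simp

lemma mi_order_add: "mi_order (\<beta>(i := Suc (\<beta> i))) = Suc (mi_order \<beta>)"
  using exhaust_3[of i] by (auto simp: mi_order_def sum_3)

text \<open>\<open>mi_deriv\<close> differentiates in direction 3 first and in direction 1 last. A
  new outermost partial is moved inwards past the blocks of smaller index until it meets the block
  of its own direction.\<close>

lemma partial_mi_deriv:
  assumes "open S" "Ck_on (Suc (mi_order \<beta>)) f S" "x \<in> S"
  shows "partial i (mi_deriv \<beta> f) x = mi_deriv (\<beta>(i := Suc (\<beta> i))) f x"
proof -
  let ?a = "\<beta> 1" and ?b = "\<beta> 2" and ?c = "\<beta> 3"
  have o: "mi_order \<beta> = ?a + ?b + ?c" by (simp add: mi_order_def sum_3)
  define u where "u = (partial 3 ^^ ?c) f"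
  define v where "v = (partial 2 ^^ ?b) u"
  have u: "Ck_on (Suc (?a + ?b)) u S"
    using Ck_on_iter[OF assms(2), of ?c 3] unfolding u_def o by (simp add: Suc_diff_le)
  have v: "Ck_on (Suc ?a) v S"
    using Ck_on_iter[OF u, of ?b 2] unfolding v_def by (simp add: Suc_diff_le)
  have c: "\<And>y. y \<in> S \<Longrightarrow> partial i u y = (partial 3 ^^ ?c) (partial i f) y"
    unfolding u_def by (rule partial_iter_commute[OF assms(1)])
      (simp_all only: Ck_on_antimono[OF assms(2), of "Suc ?c"] o le_add2 Suc_le_mono)
  have b: "\<And>y. y \<in> S \<Longrightarrow> partial i v y = (partial 2 ^^ ?b) (partial i u) y"
    unfolding v_def by (rule partial_iter_commute[OF assms(1)])
      (simp_all only: Ck_on_antimono[OF u, of "Suc ?b"] le_add2 Suc_le_mono)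
  have a: "partial i (mi_deriv \<beta> f) x = (partial 1 ^^ ?a) (partial i v) x"
    unfolding mi_deriv_def u_def[symmetric] v_def[symmetric]
    by (rule partial_iter_commute[OF assms(1) v assms(3)])
  consider "i = 1" | "i = 2" | "i = 3" using exhaust_3 by blast
  then show ?thesis
  proof cases
    case 1
    then show ?thesis by (simp add: mi_deriv_def)
  next
    case 2
    have "(partial 1 ^^ ?a) (partial 2 v) x = (partial 1 ^^ ?a) ((partial 2 ^^ Suc ?b) u) x"
      unfolding v_def by simp
    then show ?thesis using a 2 by (simp add: mi_deriv_def u_def)
  next
    case 3
    have "partial 3 u = (partial 3 ^^ Suc ?c) f" unfolding u_def by simp
    then have "(partial 1 ^^ ?a) (partial 3 v) x = (partial 1 ^^ ?a) ((partial 2 ^^ ?b) ((partial 3 ^^ Suc ?c) f)) x"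
      using iter_cong[OF assms(1) b assms(3), where i = 1 and n = ?a] 3 by simp
    then show ?thesis using a 3 by (simp add: mi_deriv_def)
  qed
qed

lemma Ck_on_mi_deriv:
  assumes "Ck_on k f S" "mi_order \<beta> \<le> k"
  shows "Ck_on (k - mi_order \<beta>) (mi_deriv \<beta> f) S"
proof -
  have o: "mi_order \<beta> = \<beta> 1 + \<beta> 2 + \<beta> 3" by (simp add: mi_order_def sum_3)
  have "Ck_on (k - \<beta> 3 - \<beta> 2 - \<beta> 1) (mi_deriv \<beta> f) S"
    unfolding mi_deriv_def
    using assms o by (intro Ck_on_iter) auto
  moreover have "k - \<beta> 3 - \<beta> 2 - \<beta> 1 = k - mi_order \<beta>" using o by simp
  ultimately show ?thesis by simp
qed

section \<open>Lipschitz bounds on a ball from bounds on the partials\<close>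

lemma axis_step_bound:
  assumes C: "Ck_on (Suc k) f (ball z R)" "\<And>y. y \<in> ball z R \<Longrightarrow> norm (partial i f y) \<le> C"
    and x: "x \<in> ball z R" "x + h *\<^sub>R axis i 1 \<in> ball z R"
  shows "norm (f (x + h *\<^sub>R axis i 1) - f x) \<le> C * \<bar>h\<bar>"
proof -
  have "norm (f (x + h *\<^sub>R axis i 1) - f (x + 0 *\<^sub>R axis i 1) - h *\<^sub>R 0) \<le> C * \<bar>h\<bar>"
  proof (rule vector_mean_value_bound[where g = "\<lambda>t. f (x + t *\<^sub>R axis i 1)"
        and g' = "\<lambda>t. partial i f (x + t *\<^sub>R axis i 1)"])
    fix s assume "s \<in> closed_segment 0 h"
    then obtain u where u: "0 \<le> u" "u \<le> 1" "s = u * h" by (auto simp: closed_segment_def)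
    have "x + s *\<^sub>R axis i 1 = (1 - u) *\<^sub>R x + u *\<^sub>R (x + h *\<^sub>R axis i 1)"
      using u by (simp add: algebra_simps)
    also have "\<dots> \<in> ball z R"
      using u x by (intro convexD_alt[OF convex_ball]) auto
    finally have s: "x + s *\<^sub>R axis i 1 \<in> ball z R" .
    show "((\<lambda>t. f (x + t *\<^sub>R axis i 1)) has_vector_derivative partial i f (x + s *\<^sub>R axis i 1)) (at s)"
      by (rule Ck_on_has_vector_derivative[OF C(1) s])
    show "norm (partial i f (x + s *\<^sub>R axis i 1) - 0) \<le> C" using C(2)[OF s] by simp
  qed
  then show ?thesis by simp
qed

text \<open>
  Moving one coordinate at a time towards \<open>z\<close> never leaves the ball, so any two points are joined
  inside it by an axis-parallel path through the point that takes, in each coordinate, the value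
  nearer to that of \<open>z\<close>. Each coordinate then moves by \<open>\<bar>x $ i - y $ i\<bar>\<close> in total.
\<close>

lemma inward_path_bound:
  fixes x m z :: "real^3"
  assumes C: "Ck_on (Suc k) f (ball z R)" "\<And>i y. y \<in> ball z R \<Longrightarrow> norm (partial i f y) \<le> C"
    and x: "x \<in> ball z R" and m: "\<And>i. \<bar>m $ i - z $ i\<bar> \<le> \<bar>x $ i - z $ i\<bar>"
  shows "norm (f m - f x) \<le> C * (\<Sum>i\<in>UNIV. \<bar>m $ i - x $ i\<bar>)"
proof -
  \<comment> \<open>\<open>A\<close> collects the coordinates already moved from \<open>x\<close> to
    \<open>m\<close>; the induction on \<open>A\<close> takes one axis step at a time.\<close>
  define p :: "3 set \<Rightarrow> real^3" where "p A = (\<chi> i. if i \<in> A then m $ i else x $ i)" for A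
  have p: "p A \<in> ball z R" for A
  proof -
    have "norm (p A - z) \<le> norm (x - z)"
      by (rule norm_le_componentwise_cart) (use m in \<open>auto simp: p_def\<close>)
    then show ?thesis using x by (simp add: dist_norm norm_minus_commute)
  qed
  have "norm (f (p A) - f x) \<le> C * (\<Sum>i\<in>A. \<bar>m $ i - x $ i\<bar>)" if "finite A" for A
    using that
  proof (induction A)
    case empty
    have "p {} = x" by (simp add: p_def vec_eq_iff)
    then show ?case by simp
  next
    case (insert i A)
    have eq: "p (insert i A) = p A + (m $ i - x $ i) *\<^sub>R axis i 1"
      using insert by (auto simp: p_def vec_eq_iff axis_def)
    have "norm (f (p (insert i A)) - f (p A)) \<le> C * \<bar>m $ i - x $ i\<bar>"
      using axis_step_bound[OF C(1) C(2) p[of A], where h = "m $ i - x $ i"] p[of "insert i A"] eq by simp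
    then have "norm (f (p (insert i A)) - f x) \<le> C * \<bar>m $ i - x $ i\<bar> + C * (\<Sum>i\<in>A. \<bar>m $ i - x $ i\<bar>)"
      using norm_triangle_ineq[of "f (p (insert i A)) - f (p A)" "f (p A) - f x"] insert by simp
    then show ?case using insert by (simp add: algebra_simps)
  qed
  from this[of UNIV] show ?thesis by (simp add: p_def)
qed

lemma Lipschitz_ball:
  fixes x y z :: "real^3"
  assumes C: "Ck_on (Suc k) f (ball z R)" "\<And>i y. y \<in> ball z R \<Longrightarrow> norm (partial i f y) \<le> C"
    and xy: "x \<in> ball z R" "y \<in> ball z R"
  shows "norm (f x - f y) \<le> 3 * C * norm (x - y)"
proof -
  define m :: "real^3" where "m = (\<chi> i. if \<bar>x $ i - z $ i\<bar> \<le> \<bar>y $ i - z $ i\<bar> then x $ i else y $ i)"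
  have C0: "0 \<le> C" using C(2)[OF xy(1)] norm_ge_zero order_trans by blast
  have mx: "norm (f m - f x) \<le> C * (\<Sum>i\<in>UNIV. \<bar>m $ i - x $ i\<bar>)"
    by (rule inward_path_bound[OF C xy(1)]) (auto simp: m_def)
  have my: "norm (f m - f y) \<le> C * (\<Sum>i\<in>UNIV. \<bar>m $ i - y $ i\<bar>)"
    by (rule inward_path_bound[OF C xy(2)]) (auto simp: m_def)
  have "norm (f x - f y) \<le> norm (f m - f x) + norm (f m - f y)"
    using norm_triangle_ineq4[of "f m - f y" "f m - f x"] by simp
  also have "\<dots> \<le> C * (\<Sum>i\<in>UNIV. \<bar>m $ i - x $ i\<bar> + \<bar>m $ i - y $ i\<bar>)"
    using mx my by (simp add: sum.distrib distrib_left)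
  \<comment> \<open>Each coordinate of \<open>m\<close> is that of \<open>x\<close> or that of
    \<open>y\<close>, so one of the two terms vanishes. Bounding each of the three coordinates of
    \<open>x - y\<close> by the norm then gives the factor 3.\<close>
  also have "(\<Sum>i\<in>UNIV. \<bar>m $ i - x $ i\<bar> + \<bar>m $ i - y $ i\<bar>) = (\<Sum>i\<in>UNIV. \<bar>(x - y) $ i\<bar>)"
    by (rule sum.cong) (auto simp: m_def)
  also have "C * \<dots> \<le> C * (\<Sum>i\<in>(UNIV :: 3 set). norm (x - y))"
    by (intro mult_left_mono sum_mono component_le_norm_cart C0)
  finally show ?thesis by (simp add: mult_ac)
qed

section \<open>Equicontinuity on the closure and extraction of subsequences\<close>

text \<open>Both sides are continuous on the closure of \<open>S \<times> S\<close>, so the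
  inequality persists there. This carries a modulus from derivatives on the open ball over to their
  extensions.\<close>

lemma modulus_on_closure:
  fixes u :: "'a::real_normed_vector \<Rightarrow> 'b::real_normed_vector"
  assumes u: "continuous_on (closure S) u" and \<omega>: "continuous_on {0..} \<omega>"
    and le: "\<And>x y. x \<in> S \<Longrightarrow> y \<in> S \<Longrightarrow> norm (u x - u y) \<le> \<omega> (norm (x - y))"
    and "x \<in> closure S" "y \<in> closure S"
  shows "norm (u x - u y) \<le> \<omega> (norm (x - y))"
proof -
  let ?h = "\<lambda>p. norm (u (fst p) - u (snd p)) - \<omega> (norm (fst p - snd p))"
  have "continuous_on (closure (S \<times> S)) ?h"
    unfolding closure_Times
    by (intro continuous_intros continuous_on_compose2[OF u] continuous_on_compose2[OF \<omega>]) auto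
  then have "?h (x, y) \<le> 0"
    by (rule continuous_le_on_closure) (use assms in \<open>auto simp: closure_Times\<close>)
  then show ?thesis by simp
qed

text \<open>One extraction per index, each along the subsequence already found; uniform limits
  survive further thinning. The index set will be the finitely many multi-indices of order at most
  k.\<close>

lemma Arzela_Ascoli_finite_family:
  fixes F :: "nat \<Rightarrow> 'i \<Rightarrow> 'a::euclidean_space \<Rightarrow> 'b::{real_normed_vector,heine_borel}"
  assumes "finite B" "compact T" and \<omega>: "continuous_on {0..} \<omega>" "\<omega> 0 = 0"
    and bound: "\<And>n i x. i \<in> B \<Longrightarrow> x \<in> T \<Longrightarrow> norm (F n i x) \<le> M"
    and modulus: "\<And>n i x y. i \<in> B \<Longrightarrow> x \<in> T \<Longrightarrow> y \<in> T \<Longrightarrow> norm (F n i x - F n i y) \<le> \<omega> (norm (x - y))"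
  shows "\<exists>r G. strict_mono r \<and>
    (\<forall>i\<in>B. continuous_on T (G i) \<and> uniform_limit T (\<lambda>n. F (r n) i) (G i) sequentially)"
  using assms(1) bound modulus
proof (induction B)
  case empty
  then show ?case using strict_mono_id by blast
next
  case (insert j B)
  then obtain r G where r: "strict_mono r" and
    G: "\<forall>i\<in>B. continuous_on T (G i) \<and> uniform_limit T (\<lambda>n. F (r n) i) (G i) sequentially"
    by fastforce
  have "\<exists>d>0. \<forall>n y. y \<in> T \<and> norm (x - y) < d \<longrightarrow> norm (F (r n) j x - F (r n) j y) < e"
    if x: "x \<in> T" and e: "0 < e" for x e
  proof -
    obtain d where d: "d > 0" "\<And>t. 0 \<le> t \<Longrightarrow> t < d \<Longrightarrow> \<omega> t < e"
    proof -
      obtain d where "d > 0" "\<forall>t\<in>{0..}. dist t 0 < d \<longrightarrow> dist (\<omega> t) (\<omega> 0) < e"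
        using \<omega>(1) e unfolding continuous_on_iff by (meson atLeast_iff order_refl)
      then show ?thesis using \<omega>(2) by (intro that[of d]) (auto simp: dist_real_def)
    qed
    have "norm (F (r n) j x - F (r n) j y) < e" if "y \<in> T" "norm (x - y) < d" for n y
      using insert.prems(2)[of j x y "r n"] d(2)[of "norm (x - y)"] that x by (simp add: le_less_trans)
    then show ?thesis using d(1) by blast
  qed
  note equicont = this
  obtain g s where g: "continuous_on T g" and s: "strict_mono (s :: nat \<Rightarrow> nat)" and
    lim: "\<And>e. 0 < e \<Longrightarrow> \<exists>N. \<forall>n x. n \<ge> N \<and> x \<in> T \<longrightarrow> norm (F (r (s n)) j x - g x) < e"
    by (rule Arzela_Ascoli[OF assms(2), of "\<lambda>n. F (r n) j" M]) (use insert.prems(1) equicont in blast)+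
  have "uniform_limit T (\<lambda>n. F (r (s n)) j) g sequentially"
    unfolding uniform_limit_sequentially_iff dist_norm using lim by blast
  moreover have "uniform_limit T (\<lambda>n. F (r (s n)) i) (G i) sequentially" if "i \<in> B" for i
    using G that filterlim_compose[OF _ filterlim_subseq[OF s]] by blast
  moreover have "strict_mono (\<lambda>n. r (s n))"
    using strict_mono_o[OF r s] by (simp add: o_def)
  ultimately show ?case
    using G g insert.hyps by (intro exI[of _ "\<lambda>n. r (s n)"] exI[of _ "G(j := g)"]) auto
qed

section \<open>Derivatives of uniform limits\<close>

text \<open>Term-by-term differentiation in one variable, on the open convex set \<open>T\<close> of
  parameters for which the line through \<open>x\<close> stays in \<open>S\<close>.\<close>

lemma has_vector_derivative_uniform_limit:
  assumes S: "open S" "convex S" "x \<in> S" and f: "\<And>n. Ck_on (Suc k) (f n) S"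
    and g: "uniform_limit S f g sequentially"
    and h: "uniform_limit S (\<lambda>n. partial i (f n)) h sequentially"
  shows "((\<lambda>t. g (x + t *\<^sub>R axis i 1)) has_vector_derivative h x) (at 0)"
proof -
  define T where "T = (\<lambda>t. x + t *\<^sub>R axis i (1::real)) -` S"
  have T: "open T" "0 \<in> T"
    unfolding T_def using S by (auto intro!: continuous_open_vimage continuous_intros)
  have cT: "convex T"
  proof (rule convexI)
    fix a b u v :: real assume ab: "a \<in> T" "b \<in> T" and uv: "0 \<le> u" "0 \<le> v" "u + v = 1"
    have "u *\<^sub>R (x + a *\<^sub>R axis i 1) + v *\<^sub>R (x + b *\<^sub>R axis i 1) \<in> S"
      using ab uv convexD[OF S(2)] by (auto simp: T_def)
    moreover have "u *\<^sub>R (x + a *\<^sub>R axis i 1) + v *\<^sub>R (x + b *\<^sub>R axis i 1) =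
        (u + v) *\<^sub>R x + (u * a + v * b) *\<^sub>R axis i (1::real)"
      by (simp add: algebra_simps)
    ultimately show "u *\<^sub>R a + v *\<^sub>R b \<in> T" using uv by (simp add: T_def)
  qed
  have "\<exists>g'. \<forall>t\<in>T. (\<lambda>n. f n (x + t *\<^sub>R axis i 1)) \<longlonglongrightarrow> g' t \<and>
      (g' has_derivative (\<lambda>u. u *\<^sub>R h (x + t *\<^sub>R axis i 1))) (at t within T)"
  proof (rule has_derivative_sequence[OF cT _ _ T(2)])
    show "((\<lambda>t. f n (x + t *\<^sub>R axis i 1)) has_derivative
        (\<lambda>u. u *\<^sub>R partial i (f n) (x + t *\<^sub>R axis i 1))) (at t within T)" if "t \<in> T" for n t
      using Ck_on_has_vector_derivative[OF f, of x t i] that has_vector_derivative_at_within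
      unfolding T_def has_vector_derivative_def[symmetric] by blast
    show "\<forall>\<^sub>F n in sequentially. \<forall>t\<in>T. \<forall>u. norm (u *\<^sub>R partial i (f n) (x + t *\<^sub>R axis i 1)
        - u *\<^sub>R h (x + t *\<^sub>R axis i 1)) \<le> e * norm u" if "e > 0" for e
      using uniform_limitD[OF h that]
    proof eventually_elim
      case (elim n)
      show ?case
      proof (intro ballI allI)
        fix t u :: real assume "t \<in> T"
        then have "norm (partial i (f n) (x + t *\<^sub>R axis i 1) - h (x + t *\<^sub>R axis i 1)) \<le> e"
          using elim by (auto simp: T_def dist_norm intro: less_imp_le)
        then show "norm (u *\<^sub>R partial i (f n) (x + t *\<^sub>R axis i 1) - u *\<^sub>R h (x + t *\<^sub>R axis i 1)) \<le> e * norm u"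
          by (simp add: scaleR_diff_right[symmetric] mult.commute[of e] mult_left_mono)
      qed
    qed
    show "(\<lambda>n. f n (x + 0 *\<^sub>R axis i 1)) \<longlonglongrightarrow> g x"
      using tendsto_uniform_limitI[OF g S(3)] by simp
  qed
  then obtain g' where g': "\<And>t. t \<in> T \<Longrightarrow> (\<lambda>n. f n (x + t *\<^sub>R axis i 1)) \<longlonglongrightarrow> g' t"
      "\<And>t. t \<in> T \<Longrightarrow> (g' has_derivative (\<lambda>u. u *\<^sub>R h (x + t *\<^sub>R axis i 1))) (at t within T)"
    by blast
  \<comment> \<open>\<open>has_derivative_sequence\<close> provides a limit function of its own;
    uniqueness of limits identifies it with \<open>g\<close> on the line.\<close>
  have eq: "g' t = g (x + t *\<^sub>R axis i 1)" if "t \<in> T" for t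
    using LIMSEQ_unique[OF g'(1)[OF that] tendsto_uniform_limitI[OF g]] that by (simp add: T_def)
  have "(g' has_vector_derivative h x) (at 0)"
    using g'(2)[OF T(2)] at_within_open[OF T(2,1)] by (simp add: has_vector_derivative_def)
  then show ?thesis
    by (rule has_vector_derivative_transform_within_open[OF _ T]) (rule eq)
qed

context
  fixes S :: "(real^3) set" and k :: nat and f :: "nat \<Rightarrow> real^3 \<Rightarrow> real^3"
    and G :: "(3 \<Rightarrow> nat) \<Rightarrow> real^3 \<Rightarrow> real^3"
  assumes S: "open S" "convex S" and f: "\<And>n. Ck_on k (f n) S"
    and lim: "\<And>\<beta>. mi_order \<beta> \<le> k \<Longrightarrow> uniform_limit S (\<lambda>n. mi_deriv \<beta> (f n)) (G \<beta>) sequentially"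
begin

text \<open>Below order k the partials of the approximants are themselves multi-index derivatives,
  hence converge uniformly by assumption, and differentiation passes to the limit.\<close>

lemma limit_has_partial:
  assumes "mi_order \<beta> < k" "x \<in> S"
  shows "((\<lambda>t. G \<beta> (x + t *\<^sub>R axis i 1)) has_vector_derivative G (\<beta>(i := Suc (\<beta> i))) x) (at 0)"
proof (rule has_vector_derivative_uniform_limit[OF S assms(2)])
  show "Ck_on (Suc (k - Suc (mi_order \<beta>))) (mi_deriv \<beta> (f n)) S" for n
    using Ck_on_mi_deriv[OF f, of \<beta> n] assms(1) by (simp add: Suc_diff_Suc)
  show "uniform_limit S (\<lambda>n. mi_deriv \<beta> (f n)) (G \<beta>) sequentially"
    using lim assms by simp
  have "uniform_limit S (\<lambda>n. mi_deriv (\<beta>(i := Suc (\<beta> i))) (f n)) (G (\<beta>(i := Suc (\<beta> i)))) sequentially"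
    by (rule lim) (use assms in \<open>simp add: mi_order_add\<close>)
  then show "uniform_limit S (\<lambda>n. partial i (mi_deriv \<beta> (f n))) (G (\<beta>(i := Suc (\<beta> i)))) sequentially"
  proof (rule iffD1[OF uniform_limit_cong', rotated 2])
    show "mi_deriv (\<beta>(i := Suc (\<beta> i))) (f n) x = partial i (mi_deriv \<beta> (f n)) x" if "x \<in> S" for n x
      using partial_mi_deriv[OF S(1) Ck_on_antimono[OF f] that] assms(1) by simp
  qed simp
qed

text \<open>The partials of \<open>G \<beta>\<close> are again members of the family, of order one
  higher, so the induction on the remaining smoothness \<open>l\<close> must range over all \<beta>.
  The zero multi-index then gives the limit map itself.\<close>

lemma Ck_on_limit: "mi_order \<beta> + l = k \<Longrightarrow> Ck_on l (G \<beta>) S"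
proof (induction l arbitrary: \<beta>)
  case 0
  have "continuous_on S (mi_deriv \<beta> (f n))" for n
    using Ck_on_antimono[OF Ck_on_mi_deriv[OF f], of \<beta> 0 n] 0 by simp
  then show ?case
    using uniform_limit_theorem[OF _ lim] 0 by simp
next
  case (Suc l)
  have "continuous_on S (mi_deriv \<beta> (f n))" for n
    using Ck_on_antimono[OF Ck_on_mi_deriv[OF f], of \<beta> 0 n] Suc by simp
  then have "continuous_on S (G \<beta>)"
    using uniform_limit_theorem[OF _ lim] Suc by simp
  moreover have "(\<lambda>t. G \<beta> (x + t *\<^sub>R axis i 1)) differentiable (at 0)" if "x \<in> S" for x i
    by (rule differentiableI_vector[OF limit_has_partial]) (use that Suc in auto)
  moreover have "Ck_on l (partial i (G \<beta>)) S" for i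
  proof (rule Ck_on_cong[OF S(1)])
    show "Ck_on l (G (\<beta>(i := Suc (\<beta> i)))) S"
      using Suc.prems by (intro Suc.IH) (simp only: mi_order_add add_Suc add_Suc_right)
    show "G (\<beta>(i := Suc (\<beta> i))) y = partial i (G \<beta>) y" if "y \<in> S" for y
      by (rule partial_eqI[symmetric, OF limit_has_partial]) (use that Suc in auto)
  qed
  ultimately show ?case by simp
qed

lemma mi_deriv_limit: "mi_order \<beta> \<le> k \<Longrightarrow> x \<in> S \<Longrightarrow> mi_deriv \<beta> (G (\<lambda>_. 0)) x = G \<beta> x"
proof (induction "mi_order \<beta>" arbitrary: \<beta> x)
  case 0
  then have "\<beta> = (\<lambda>_. 0)" by (auto simp: mi_order_def)
  then show ?case by (simp add: mi_zero)
next
  case (Suc m)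
  \<comment> \<open>Any direction occurring in \<beta> will do: \<open>partial_mi_deriv\<close>
    makes it the outermost one.\<close>
  then obtain i where i: "\<beta> i \<noteq> 0" by (metis (mono_tags, lifting) mi_order_def sum.neutral Zero_not_Suc)
  define \<gamma> where "\<gamma> = \<beta>(i := \<beta> i - 1)"
  have \<beta>: "\<beta> = \<gamma>(i := Suc (\<gamma> i))" using i by (auto simp: \<gamma>_def)
  then have \<gamma>: "mi_order \<beta> = Suc (mi_order \<gamma>)" using mi_order_add by metis
  have "Ck_on k (G (\<lambda>_. 0)) S" by (rule Ck_on_limit) (simp add: mi_zero)
  then have "mi_deriv \<beta> (G (\<lambda>_. 0)) x = partial i (mi_deriv \<gamma> (G (\<lambda>_. 0))) x"
    using partial_mi_deriv[OF S(1) Ck_on_antimono Suc.prems(2), of k "G (\<lambda>_. 0)" \<gamma> i] \<beta> \<gamma> Suc.prems by simp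
  also have "\<dots> = partial i (G \<gamma>) x"
    by (rule partial_cong[OF S(1) _ Suc.prems(2)]) (use Suc \<gamma> in auto)
  also have "\<dots> = G \<beta> x"
    using partial_eqI[OF limit_has_partial] \<beta> \<gamma> Suc.prems by simp
  finally show ?case .
qed

end

section \<open>The Hoelder norm in terms of sampled points\<close>

lemma mi_deriv_cong:
  assumes "open S" "\<And>y. y \<in> S \<Longrightarrow> f y = g y" "x \<in> S"
  shows "mi_deriv \<beta> f x = mi_deriv \<beta> g x"
  unfolding mi_deriv_def by (intro iter_cong[OF assms(1)] assms)

lemma Holder_space_regD: "f \<in> Holder_space k \<alpha> S \<Longrightarrow> Holder_reg k \<alpha> S f"
  by (simp add: Holder_space_def Holder_reg_def)

text \<open>Together with \<open>Holder_norm_le\<close> this turns a norm bound into inequalities at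
  finitely many points, each of which survives pointwise limits. The sup norm and the seminorm are
  sampled independently because the norm adds two suprema.\<close>

lemma Holder_norm_ge:
  assumes S: "bounded S" and f: "Holder_reg k \<alpha> S f" and "\<alpha> \<noteq> 0"
    and "mi_order \<beta> \<le> k" "mi_order \<gamma> = k" "u \<in> S" "x \<in> S" "y \<in> S" "x \<noteq> y"
  shows "norm (mi_deriv \<beta> f u) + norm (mi_deriv \<gamma> f x - mi_deriv \<gamma> f y) / norm (x - y) powr \<alpha>
    \<le> Holder_norm k \<alpha> S f"
proof -
  have "norm (mi_deriv \<beta> f u) \<le> Ck_norm k S f"
    using assms by (intro norm_le_Ck_norm) (auto simp: Holder_reg_def)
  moreover have "norm (mi_deriv \<gamma> f x - mi_deriv \<gamma> f y) / norm (x - y) powr \<alpha> \<le> Holder_seminorm k \<alpha> S f"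
    using assms by (intro quotient_le_Holder_seminorm) (auto simp: Holder_reg_def)
  ultimately show ?thesis using \<open>\<alpha> \<noteq> 0\<close> by (simp add: Holder_norm_def)
qed

lemma Holder_norm_le:
  assumes S: "open S" "S \<noteq> {}" and "\<alpha> \<noteq> 0"
    and le: "\<And>\<beta> \<gamma> u x y. mi_order \<beta> \<le> k \<Longrightarrow> mi_order \<gamma> = k \<Longrightarrow> u \<in> S \<Longrightarrow> x \<in> S \<Longrightarrow> y \<in> S \<Longrightarrow> x \<noteq> y \<Longrightarrow>
      norm (mi_deriv \<beta> f u) + norm (mi_deriv \<gamma> f x - mi_deriv \<gamma> f y) / norm (x - y) powr \<alpha> \<le> K"
  shows "Holder_norm k \<alpha> S f \<le> K"
proof -
  \<comment> \<open>The two suprema are taken one at a time: first over \<beta> and u with \<gamma>,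
    x, y fixed, then over the latter.\<close>
  have "Holder_seminorm k \<alpha> S f \<le> K - Ck_norm k S f"
  proof (rule Holder_seminorm_le[OF S])
    fix \<gamma> x y assume a: "mi_order \<gamma> = k" "x \<in> S" "y \<in> S" "x \<noteq> y"
    have "Ck_norm k S f \<le> K - norm (mi_deriv \<gamma> f x - mi_deriv \<gamma> f y) / norm (x - y) powr \<alpha>"
    proof (rule Ck_norm_le[OF S(2)])
      fix \<beta> u assume "mi_order \<beta> \<le> k" "u \<in> S"
      then show "norm (mi_deriv \<beta> f u) \<le> K - norm (mi_deriv \<gamma> f x - mi_deriv \<gamma> f y) / norm (x - y) powr \<alpha>"
        using le[of \<beta> \<gamma> u x y] a by linarith
    qed
    then show "norm (mi_deriv \<gamma> f x - mi_deriv \<gamma> f y) / norm (x - y) powr \<alpha> \<le> K - Ck_norm k S f"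
      by linarith
  qed
  then show ?thesis using \<open>\<alpha> \<noteq> 0\<close> by (simp add: Holder_norm_def)
qed

lemma norm_mi_deriv_le:
  assumes "open S" "bounded S" "Holder_reg k \<alpha> S f" "Holder_norm k \<alpha> S f \<le> K" "mi_order \<beta> \<le> k" "x \<in> S"
  shows "norm (mi_deriv \<beta> f x) \<le> K"
proof -
  have "norm (mi_deriv \<beta> f x) \<le> Ck_norm k S f"
    using assms by (intro norm_le_Ck_norm) (auto simp: Holder_reg_def)
  also have "\<dots> \<le> Holder_norm k \<alpha> S f"
    using assms by (intro Ck_norm_le_Holder_norm) auto
  finally show ?thesis using assms(4) by linarith
qed

lemma norm_mi_deriv_diff_le:
  assumes "open S" "bounded S" "Holder_reg k \<alpha> S f" "Holder_norm k \<alpha> S f \<le> K" "\<alpha> \<noteq> 0"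
    "mi_order \<beta> = k" "x \<in> S" "y \<in> S"
  shows "norm (mi_deriv \<beta> f x - mi_deriv \<beta> f y) \<le> K * norm (x - y) powr \<alpha>"
proof (cases "x = y")
  case False
  have "norm (mi_deriv \<beta> f x) + norm (mi_deriv \<beta> f x - mi_deriv \<beta> f y) / norm (x - y) powr \<alpha> \<le> K"
    using Holder_norm_ge[of S k \<alpha> f \<beta> \<beta> x x y] assms False by simp
  then have "norm (mi_deriv \<beta> f x - mi_deriv \<beta> f y) / norm (x - y) powr \<alpha> \<le> K"
    using norm_ge_zero[of "mi_deriv \<beta> f x"] by linarith
  then show ?thesis using False by (simp add: divide_le_eq)
qed simp

text \<open>Below order k the next derivatives are bounded by K, and \<open>Lipschitz_ball\<close>
  gives 3 * K; at order k the Hoelder bound applies. The sum of both terms is one modulus for all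
  orders.\<close>

lemma mi_deriv_modulus:
  assumes f: "Holder_reg k \<alpha> (ball z R) f" "Holder_norm k \<alpha> (ball z R) f \<le> K" and "\<alpha> \<noteq> 0"
    and \<beta>: "mi_order \<beta> \<le> k" and xy: "x \<in> ball z R" "y \<in> ball z R"
  shows "norm (mi_deriv \<beta> f x - mi_deriv \<beta> f y) \<le> 3 * K * norm (x - y) + K * norm (x - y) powr \<alpha>"
proof -
  let ?S = "ball z R"
  have K: "0 \<le> K"
    using norm_mi_deriv_le[OF open_ball bounded_ball f \<beta> xy(1)] norm_ge_zero order_trans by blast
  have C: "Ck_on k f ?S" using f by (simp add: Holder_reg_def Ck_closure_def)
  show ?thesis
  proof (cases "mi_order \<beta> = k")
    case True
    then show ?thesis
      using norm_mi_deriv_diff_le[OF open_ball bounded_ball f \<open>\<alpha> \<noteq> 0\<close> _ xy] K by (simp add: add_increasing)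
  next
    case False
    have "norm (mi_deriv \<beta> f x - mi_deriv \<beta> f y) \<le> 3 * K * norm (x - y)"
    proof (rule Lipschitz_ball[OF _ _ xy])
      show "Ck_on (Suc (k - Suc (mi_order \<beta>))) (mi_deriv \<beta> f) ?S"
        using Ck_on_mi_deriv[OF C \<beta>] \<beta> False by (simp add: Suc_diff_Suc)
      fix i y assume y: "y \<in> ?S"
      have "partial i (mi_deriv \<beta> f) y = mi_deriv (\<beta>(i := Suc (\<beta> i))) f y"
        using \<beta> False by (intro partial_mi_deriv[OF open_ball Ck_on_antimono[OF C] y]) simp
      moreover have "mi_order (\<beta>(i := Suc (\<beta> i))) \<le> k"
        using \<beta> False unfolding mi_order_add by simp
      ultimately show "norm (partial i (mi_deriv \<beta> f) y) \<le> K"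
        using norm_mi_deriv_le[OF open_ball bounded_ball f _ y] by simp
    qed
    then show ?thesis using K by (simp add: add_increasing2)
  qed
qed

section \<open>Convergent subsequences of Hoelder-bounded sequences\<close>

lemma Holder_bounded_subsequence:
  assumes "0 < R" "0 < \<alpha>" and f: "\<And>n. f n \<in> Holder_space k \<alpha> (ball z R)"
    and K: "\<And>n. Holder_norm k \<alpha> (ball z R) (f n) \<le> K"
  obtains r g where "strict_mono (r :: nat \<Rightarrow> nat)" "g \<in> Holder_space k \<alpha> (ball z R)"
    "Holder_norm k \<alpha> (ball z R) g \<le> K"
    "uniform_limit (closure (ball z R)) (\<lambda>n. f (r n)) g sequentially"
    "\<And>\<beta>. mi_order \<beta> \<le> k \<Longrightarrow>
      uniform_limit (ball z R) (\<lambda>n. mi_deriv \<beta> (f (r n))) (mi_deriv \<beta> g) sequentially"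
proof -
  define S where "S = ball z R"
  define B where "B = {\<beta>. mi_order \<beta> \<le> k}"
  define \<omega> where "\<omega> t = 3 * K * t + K * t powr \<alpha>" for t
  have S: "open S" "bounded S" "S \<noteq> {}" "convex S" using \<open>0 < R\<close> by (auto simp: S_def)
  have reg: "Holder_reg k \<alpha> S (f n)" for n using Holder_space_regD[OF f] by (simp add: S_def)
  have nK: "Holder_norm k \<alpha> S (f n) \<le> K" for n using K by (simp add: S_def)
  have C: "Ck_on k (f n) S" for n using reg by (simp add: Holder_reg_def Ck_closure_def)
  \<comment> \<open>\<open>mi_deriv\<close> is controlled inside \<open>S\<close> only;
    \<open>F\<close> is its continuous extension to the compact closure.\<close>
  have "\<forall>n. \<forall>\<beta>\<in>B. \<exists>u. continuous_on (closure S) u \<and> (\<forall>x\<in>S. u x = mi_deriv \<beta> (f n) x)"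
    using reg by (auto simp: Holder_reg_def Ck_closure_def B_def)
  then obtain F where F: "\<And>n \<beta>. \<beta> \<in> B \<Longrightarrow> continuous_on (closure S) (F n \<beta>)"
    "\<And>n \<beta> x. \<beta> \<in> B \<Longrightarrow> x \<in> S \<Longrightarrow> F n \<beta> x = mi_deriv \<beta> (f n) x"
    by metis
  \<comment> \<open>Continuity of \<open>t powr \<alpha>\<close> at 0 rests on \<alpha> > 0.\<close>
  have \<omega>: "continuous_on {0..} \<omega>" "\<omega> 0 = 0"
    using \<open>0 < \<alpha>\<close> unfolding \<omega>_def by (auto intro!: continuous_intros continuous_on_powr')
  have bound: "norm (F n \<beta> x) \<le> K" if "\<beta> \<in> B" "x \<in> closure S" for n \<beta> x
    using norm_mi_deriv_le[OF S(1,2) reg nK] F(2) that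
    by (intro continuous_on_closure_norm_le[OF F(1)]) (auto simp: B_def)
  have modulus: "norm (F n \<beta> x - F n \<beta> y) \<le> \<omega> (norm (x - y))"
    if "\<beta> \<in> B" "x \<in> closure S" "y \<in> closure S" for n \<beta> x y
  proof (rule modulus_on_closure[OF F(1) \<omega>(1) _ that(2,3)])
    show "norm (F n \<beta> x - F n \<beta> y) \<le> \<omega> (norm (x - y))" if "x \<in> S" "y \<in> S" for x y
      using mi_deriv_modulus[OF reg[unfolded S_def] nK[unfolded S_def], of \<beta> x y n] that \<open>\<beta> \<in> B\<close> \<open>0 < \<alpha>\<close> F(2)
      by (simp add: \<omega>_def B_def S_def)
  qed (use that in auto)
  have "finite B" "compact (closure S)" using finite_mi S by (auto simp: B_def compact_closure)
  then have "\<exists>r G. strict_mono r \<and>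
    (\<forall>\<beta>\<in>B. continuous_on (closure S) (G \<beta>) \<and> uniform_limit (closure S) (\<lambda>n. F (r n) \<beta>) (G \<beta>) sequentially)"
    by (rule Arzela_Ascoli_finite_family[OF _ _ \<omega>]) (fact bound modulus)+
  then obtain r G where r: "strict_mono r" and G: "\<And>\<beta>. \<beta> \<in> B \<Longrightarrow> continuous_on (closure S) (G \<beta>)"
    "\<And>\<beta>. \<beta> \<in> B \<Longrightarrow> uniform_limit (closure S) (\<lambda>n. F (r n) \<beta>) (G \<beta>) sequentially"
    by auto
  have limS: "uniform_limit S (\<lambda>n. mi_deriv \<beta> (f (r n))) (G \<beta>) sequentially" if "mi_order \<beta> \<le> k" for \<beta>
  proof (rule iffD1[OF uniform_limit_cong'])
    show "uniform_limit S (\<lambda>n. F (r n) \<beta>) (G \<beta>) sequentially"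
      using that by (intro uniform_limit_on_subset[OF G(2) closure_subset]) (simp add: B_def)
    show "F (r n) \<beta> x = mi_deriv \<beta> (f (r n)) x" if "x \<in> S" for n x
      using that \<open>mi_order \<beta> \<le> k\<close> by (intro F(2)) (auto simp: B_def)
  qed simp
  have 0: "(\<lambda>_. 0) \<in> B" by (simp add: B_def mi_zero)
  \<comment> \<open>The restriction gives the value \<open>undefined\<close> off the closure, as
    \<open>Holder_space\<close> demands of its members.\<close>
  define g where "g = restrict (G (\<lambda>_. 0)) (closure S)"
  have g: "g x = G (\<lambda>_. 0) x" if "x \<in> closure S" for x using that by (simp add: g_def)
  have gS: "g x = G (\<lambda>_. 0) x" if "x \<in> S" for x using that closure_subset g by blast
  have Dg: "mi_deriv \<beta> g x = G \<beta> x" if "mi_order \<beta> \<le> k" "x \<in> S" for \<beta> x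
    using mi_deriv_limit[OF S(1,4) C limS that] mi_deriv_cong[OF S(1) gS that(2)] by simp
  have Cg: "Ck_closure k S g"
    unfolding Ck_closure_def
  proof (intro conjI allI impI)
    have "Ck_on k (G (\<lambda>_. 0)) S" by (rule Ck_on_limit[OF S(1,4) C limS]) (auto simp: mi_zero)
    then show "Ck_on k g S" by (rule Ck_on_cong[OF S(1), rotated]) (simp add: gS)
    show "continuous_on (closure S) g" using G(1)[OF 0] g by (simp cong: continuous_on_cong)
    show "\<exists>h. continuous_on (closure S) h \<and> (\<forall>x\<in>S. h x = mi_deriv \<beta> g x)" if "mi_order \<beta> \<le> k" for \<beta>
      using G(1) Dg that by (intro exI[of _ "G \<beta>"]) (auto simp: B_def)
  qed
  have limg: "uniform_limit S (\<lambda>n. mi_deriv \<beta> (f (r n))) (mi_deriv \<beta> g) sequentially" if "mi_order \<beta> \<le> k" for \<beta>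
    by (rule iffD1[OF uniform_limit_cong' limS[OF that]]) (use Dg[OF that] in auto)
  have pt: "(\<lambda>n. mi_deriv \<beta> (f (r n)) x) \<longlonglongrightarrow> mi_deriv \<beta> g x" if "mi_order \<beta> \<le> k" "x \<in> S" for \<beta> x
    using tendsto_uniform_limitI[OF limg] that by blast
  \<comment> \<open>Every approximant satisfies this inequality at the same sampled points, so it
    passes to the limit with the same K.\<close>
  have sum: "norm (mi_deriv \<beta> g u) + norm (mi_deriv \<gamma> g x - mi_deriv \<gamma> g y) / norm (x - y) powr \<alpha> \<le> K"
    if "mi_order \<beta> \<le> k" "mi_order \<gamma> = k" "u \<in> S" "x \<in> S" "y \<in> S" "x \<noteq> y" for \<beta> \<gamma> u x y
  proof (rule LIMSEQ_le_const2)
    show "(\<lambda>n. norm (mi_deriv \<beta> (f (r n)) u) + norm (mi_deriv \<gamma> (f (r n)) x - mi_deriv \<gamma> (f (r n)) y) / norm (x - y) powr \<alpha>)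
       \<longlonglongrightarrow> norm (mi_deriv \<beta> g u) + norm (mi_deriv \<gamma> g x - mi_deriv \<gamma> g y) / norm (x - y) powr \<alpha>"
      using that by (intro tendsto_intros pt) auto
    show "\<exists>N. \<forall>n\<ge>N. norm (mi_deriv \<beta> (f (r n)) u)
        + norm (mi_deriv \<gamma> (f (r n)) x - mi_deriv \<gamma> (f (r n)) y) / norm (x - y) powr \<alpha> \<le> K"
      using that \<open>0 < \<alpha>\<close>
      by (intro exI[of _ 0] allI impI order_trans[OF Holder_norm_ge[OF S(2) reg] nK]) auto
  qed
  have "top_derivs_Holder k \<alpha> S g"
    unfolding top_derivs_Holder_def
  proof (intro allI impI exI ballI)
    fix \<gamma> x y assume *: "mi_order \<gamma> = k" "x \<in> S" "y \<in> S"
    show "norm (mi_deriv \<gamma> g x - mi_deriv \<gamma> g y) \<le> K * norm (x - y) powr \<alpha>"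
    proof (cases "x = y")
      case False
      have "norm (mi_deriv \<gamma> g x - mi_deriv \<gamma> g y) / norm (x - y) powr \<alpha> \<le> K"
        using sum[of \<gamma> \<gamma> x x y] * False norm_ge_zero[of "mi_deriv \<gamma> g x"] by linarith
      then show ?thesis using False by (simp add: divide_le_eq)
    qed simp
  qed
  then have gH: "g \<in> Holder_space k \<alpha> S"
    using Cg by (simp add: Holder_space_def g_def)
  have "Holder_norm k \<alpha> S g \<le> K"
    by (rule Holder_norm_le[OF S(1,3)]) (use sum \<open>0 < \<alpha>\<close> in auto)
  moreover have "uniform_limit (closure S) (\<lambda>n. f (r n)) g sequentially"
  proof -
    \<comment> \<open>The extension of the zeroth derivative is \<open>f n\<close> itself, also on
      the boundary, by continuity; hence convergence is uniform on the closed ball.\<close>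
    have "F n (\<lambda>_. 0) x - f n x = 0" if "x \<in> closure S" for n x
    proof (rule continuous_constant_on_closure[OF _ _ that])
      show "continuous_on (closure S) (\<lambda>x. F n (\<lambda>_. 0) x - f n x)"
        using F(1)[OF 0] reg[of n] by (auto intro!: continuous_intros simp: Holder_reg_def Ck_closure_def)
    qed (use F(2)[OF 0] in \<open>simp add: mi_zero\<close>)
    then show ?thesis
      using g by (intro iffD1[OF uniform_limit_cong' G(2)[OF 0]]) auto
  qed
  ultimately show ?thesis
    using that[of r g] r gH limg by (simp add: S_def)
qed

section \<open>Interpolation and convergence in the weaker norm\<close>

text \<open>Split t^\<alpha> into t^(\<alpha> - \<alpha>') and t^\<alpha>' and bound the first
  factor through the diameter. The absolute value of C appears because a Hoelder constant may be
  negative by definition.\<close>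

lemma Holder_space_mono:
  assumes "bounded S" "\<alpha>' < \<alpha>" "0 < \<alpha>"
  shows "Holder_space k \<alpha> S \<subseteq> Holder_space k \<alpha>' S"
proof -
  have "top_derivs_Holder k \<alpha>' S f" if f: "top_derivs_Holder k \<alpha> S f" for f
    unfolding top_derivs_Holder_def
  proof (intro allI impI)
    fix \<beta> :: "3 \<Rightarrow> nat" assume "mi_order \<beta> = k"
    then obtain C where C: "\<forall>x\<in>S. \<forall>y\<in>S. norm (mi_deriv \<beta> f x - mi_deriv \<beta> f y) \<le> C * norm (x - y) powr \<alpha>"
      using f unfolding top_derivs_Holder_def by blast
    have "norm (mi_deriv \<beta> f x - mi_deriv \<beta> f y) \<le> (\<bar>C\<bar> * diameter S powr (\<alpha> - \<alpha>')) * norm (x - y) powr \<alpha>'"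
      if xy: "x \<in> S" "y \<in> S" for x y
    proof -
      have "norm (x - y) \<le> diameter S"
        using diameter_bounded_bound[OF assms(1) xy] by (simp add: dist_norm)
      then have "norm (x - y) powr (\<alpha> - \<alpha>') \<le> diameter S powr (\<alpha> - \<alpha>')"
        using assms(2) by (intro powr_mono2) auto
      then have "\<bar>C\<bar> * norm (x - y) powr (\<alpha> - \<alpha>') * norm (x - y) powr \<alpha>'
          \<le> \<bar>C\<bar> * diameter S powr (\<alpha> - \<alpha>') * norm (x - y) powr \<alpha>'"
        by (intro mult_right_mono mult_left_mono) auto
      moreover have "\<bar>C\<bar> * norm (x - y) powr (\<alpha> - \<alpha>') * norm (x - y) powr \<alpha>' = \<bar>C\<bar> * norm (x - y) powr \<alpha>"
        by (simp add: powr_add[symmetric] mult.assoc)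
      moreover have "C * norm (x - y) powr \<alpha> \<le> \<bar>C\<bar> * norm (x - y) powr \<alpha>"
        by (intro mult_right_mono) auto
      moreover have "norm (mi_deriv \<beta> f x - mi_deriv \<beta> f y) \<le> C * norm (x - y) powr \<alpha>"
        using C xy by blast
      ultimately show ?thesis by linarith
    qed
    then show "\<exists>C. \<forall>x\<in>S. \<forall>y\<in>S. norm (mi_deriv \<beta> f x - mi_deriv \<beta> f y) \<le> C * norm (x - y) powr \<alpha>'" by blast
  qed
  then show ?thesis using assms(3) by (auto simp: Holder_space_def)
qed

text \<open>Write D as D^\<theta> * D^(1 - \<theta>) with \<theta> = \<alpha>'/\<alpha>, using the
  Hoelder bound in the first factor and the uniform bound in the second. This \<theta> turns
  t^\<alpha> into exactly t^\<alpha>'.\<close>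

lemma Holder_quotient_interpolation:
  fixes t :: real
  assumes "0 < t" "0 \<le> D" "D \<le> A * t powr \<alpha>" "D \<le> B" "0 \<le> \<alpha>'" "\<alpha>' < \<alpha>"
  shows "D / t powr \<alpha>' \<le> A powr (\<alpha>' / \<alpha>) * B powr (1 - \<alpha>' / \<alpha>)"
proof -
  let ?\<theta> = "\<alpha>' / \<alpha>"
  have \<alpha>: "0 < \<alpha>" using assms by simp
  have \<theta>: "0 \<le> ?\<theta>" "?\<theta> \<le> 1" using assms by auto
  have A: "0 \<le> A" using assms order_trans[OF assms(2,3)] by (simp add: zero_le_mult_iff)
  have "D = D powr ?\<theta> * D powr (1 - ?\<theta>)"
    using assms(2) by (simp add: powr_add[symmetric])
  also have "\<dots> \<le> (A * t powr \<alpha>) powr ?\<theta> * B powr (1 - ?\<theta>)"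
    using assms \<theta> by (intro mult_mono powr_mono2) auto
  also have "(A * t powr \<alpha>) powr ?\<theta> = A powr ?\<theta> * t powr \<alpha>'"
    using A \<alpha> assms by (simp add: powr_mult powr_powr)
  finally show ?thesis
    using assms by (simp add: divide_le_eq mult_ac)
qed

lemma limitin_Holder_topology:
  assumes S: "open S" "bounded S" "S \<noteq> {}" and \<alpha>: "0 \<le> \<alpha>'" "\<alpha>' < \<alpha>"
    and f: "\<And>n. f n \<in> Holder_space k \<alpha> S" "\<And>n. Holder_norm k \<alpha> S (f n) \<le> K"
    and g: "g \<in> Holder_space k \<alpha> S" "Holder_norm k \<alpha> S g \<le> K"
    and lim: "\<And>\<beta>. mi_order \<beta> \<le> k \<Longrightarrow> uniform_limit S (\<lambda>n. mi_deriv \<beta> (f n)) (mi_deriv \<beta> g) sequentially"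
  shows "limitin (Holder_topology k \<alpha>' S) f g sequentially"
proof -
  interpret Metric_space "Holder_space k \<alpha>' S" "Holder_dist k \<alpha>' S"
    by (rule Metric_space_Holder[OF S])
  have sub: "Holder_space k \<alpha> S \<subseteq> Holder_space k \<alpha>' S"
    using \<alpha> S by (intro Holder_space_mono) auto
  let ?\<theta> = "\<alpha>' / \<alpha>"
  let ?c = "(2 * K) powr ?\<theta>"
  have C: "Ck_on k (f n) S" "Ck_on k g S" for n
    using f(1)[of n] g(1) by (auto simp: Holder_space_def Ck_closure_def)
  let ?h = "\<lambda>n x. f n x - g x"
  have Dh: "mi_deriv \<beta> (?h n) x = mi_deriv \<beta> (f n) x - mi_deriv \<beta> g x" if "mi_order \<beta> \<le> k" "x \<in> S" for \<beta> n x
    using mi_deriv_lin[OF S(1) C that, of 1 n "-1"] by simp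
  \<comment> \<open>For the difference, the Hoelder constants of \<open>f n\<close> and
    \<open>g\<close> add up to 2 * K, and the sup bounds at two points to 2 * e.\<close>
  have small: "Holder_norm k \<alpha>' S (?h n) \<le> e + ?c * (2 * e) powr (1 - ?\<theta>)"
    if e: "0 < e" "\<And>\<beta> x. mi_order \<beta> \<le> k \<Longrightarrow> x \<in> S \<Longrightarrow> norm (mi_deriv \<beta> (f n) x - mi_deriv \<beta> g x) \<le> e" for n e
  proof -
    have "Ck_norm k S (?h n) \<le> e"
      using e Dh by (intro Ck_norm_le[OF S(3)]) auto
    moreover have "Holder_seminorm k \<alpha>' S (?h n) \<le> ?c * (2 * e) powr (1 - ?\<theta>)"
    proof (rule Holder_seminorm_le[OF S(1,3)])
      fix \<beta> x y assume *: "mi_order \<beta> = k" "x \<in> S" "y \<in> S" "x \<noteq> y"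
      let ?D = "norm (mi_deriv \<beta> (?h n) x - mi_deriv \<beta> (?h n) y)"
      have D: "mi_deriv \<beta> (?h n) x - mi_deriv \<beta> (?h n) y =
        (mi_deriv \<beta> (f n) x - mi_deriv \<beta> (f n) y) - (mi_deriv \<beta> g x - mi_deriv \<beta> g y)"
        using Dh * by simp
      have "?D \<le> norm (mi_deriv \<beta> (f n) x - mi_deriv \<beta> (f n) y) + norm (mi_deriv \<beta> g x - mi_deriv \<beta> g y)"
        unfolding D by (rule norm_triangle_ineq4)
      also have "\<dots> \<le> K * norm (x - y) powr \<alpha> + K * norm (x - y) powr \<alpha>"
        using f g \<alpha> * by (intro add_mono norm_mi_deriv_diff_le[OF S(1,2)] Holder_space_regD) auto
      finally have 1: "?D \<le> (2 * K) * norm (x - y) powr \<alpha>" by simp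
      have "?D \<le> norm (mi_deriv \<beta> (?h n) x) + norm (mi_deriv \<beta> (?h n) y)" by (rule norm_triangle_ineq4)
      also have "\<dots> \<le> e + e" using e(2)[of \<beta>] Dh * by (intro add_mono) auto
      finally have 2: "?D \<le> 2 * e" by simp
      show "?D / norm (x - y) powr \<alpha>' \<le> ?c * (2 * e) powr (1 - ?\<theta>)"
        by (rule Holder_quotient_interpolation[OF _ _ 1 2 \<alpha>]) (use * in auto)
    qed
    \<comment> \<open>Covers \<alpha>' = 0, where the norm has no seminorm term.\<close>
    moreover have "0 \<le> ?c * (2 * e) powr (1 - ?\<theta>)" by simp
    ultimately show ?thesis by (auto simp: Holder_norm_def)
  qed
  have "\<forall>\<^sub>F n in sequentially. f n \<in> Holder_space k \<alpha>' S \<and> Holder_dist k \<alpha>' S (f n) g < \<eta>" if "\<eta> > 0" for \<eta>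
  proof -
    \<comment> \<open>Since \<alpha>' < \<alpha>, the exponent \<open>1 - ?\<theta>\<close> is
      positive and the bound vanishes as e decreases to 0.\<close>
    have "((\<lambda>e. 2 * e) \<longlongrightarrow> 2 * 0) (at_right (0::real))" by (intro tendsto_intros)
    then have "((\<lambda>e. (2 * e) powr (1 - ?\<theta>)) \<longlongrightarrow> 0) (at_right 0)"
      using \<alpha> by (intro tendsto_zero_powrI[OF _ tendsto_const]) (auto simp: eventually_at_right_less intro!: eventually_at_rightI[of 0 1])
    then have "((\<lambda>e. e + ?c * (2 * e) powr (1 - ?\<theta>)) \<longlongrightarrow> 0 + ?c * 0) (at_right 0)"
      by (intro tendsto_intros)
    then have "\<forall>\<^sub>F e in at_right 0. e + ?c * (2 * e) powr (1 - ?\<theta>) < \<eta>"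
      using that by (intro order_tendstoD(2)) auto
    then have "\<forall>\<^sub>F e in at_right 0. 0 < e \<and> e + ?c * (2 * e) powr (1 - ?\<theta>) < \<eta>"
      using eventually_at_right_less by (rule eventually_conj[rotated])
    then obtain e where e: "0 < e" "e + ?c * (2 * e) powr (1 - ?\<theta>) < \<eta>"
      using eventually_happens' trivial_limit_at_right_real by blast
    have "\<forall>\<^sub>F n in sequentially. \<forall>\<beta>\<in>{\<beta>. mi_order \<beta> \<le> k}. \<forall>x\<in>S. dist (mi_deriv \<beta> (f n) x) (mi_deriv \<beta> g x) < e"
      using uniform_limitD[OF lim e(1)] by (intro eventually_ball_finite[OF finite_mi]) auto
    then show ?thesis
    proof eventually_elim
      case (elim n)
      have "Holder_norm k \<alpha>' S (?h n) < \<eta>"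
        using small[OF e(1), of n] elim e(2) by (force simp: dist_norm intro: less_imp_le)
      then show ?case using f(1)[of n] g(1) sub by (auto simp: Holder_dist_def)
    qed
  qed
  then show ?thesis
    unfolding Holder_topology_def limitin_metric using g(1) sub by blast
qed

section \<open>Limits of the inverses and compactness\<close>

text \<open>Function and argument both vary: uniform convergence handles the first, continuity of
  the limit the second. This passes identities between a map and its inverse to the limit.\<close>

lemma tendsto_uniform_limit_diagonal:
  fixes q :: "'a::topological_space \<Rightarrow> 'b::real_normed_vector"
  assumes "continuous_on C q" and Q: "uniform_limit C Q q F"
    and "(p \<longlongrightarrow> l) F" "\<And>n. p n \<in> C" "l \<in> C"
  shows "((\<lambda>n. Q n (p n)) \<longlongrightarrow> q l) F"
proof (rule Lim_transform2)
  show "((\<lambda>n. q (p n)) \<longlongrightarrow> q l) F"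
    using assms by (intro continuous_on_tendsto_compose[OF assms(1)]) auto
  show "((\<lambda>n. q (p n) - Q n (p n)) \<longlongrightarrow> 0) F"
  proof (rule tendstoI)
    fix e :: real assume "e > 0"
    from uniform_limitD[OF Q this] show "\<forall>\<^sub>F n in F. dist (q (p n) - Q n (p n)) 0 < e"
      by eventually_elim (use assms(4) in \<open>simp add: dist_norm norm_minus_commute\<close>)
  qed
qed

theorem lemma5p4:
  fixes k :: nat and \<alpha> \<alpha>' K R :: real and z :: "real^3"
  assumes "0 < \<alpha>" and "\<alpha> \<le> 1" and "0 < K" and "0 < R"
    and "0 \<le> \<alpha>'" and "\<alpha>' < \<alpha>"
  shows "compactin (Holder_topology k \<alpha>' (ball z R)) (U_ad k \<alpha> K (ball z R))"
proof -
  let ?S = "ball z R"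
  let ?C = "closure ?S"
  have S: "open ?S" "bounded ?S" "?S \<noteq> {}" using \<open>0 < R\<close> by auto
  interpret Metric_space "Holder_space k \<alpha>' ?S" "Holder_dist k \<alpha>' ?S"
    by (rule Metric_space_Holder[OF S])
  have "\<exists>\<Phi> r. \<Phi> \<in> U_ad k \<alpha> K ?S \<and> strict_mono r \<and> limitin mtopology (\<sigma> \<circ> r) \<Phi> sequentially"
    if \<sigma>: "range \<sigma> \<subseteq> U_ad k \<alpha> K ?S" for \<sigma> :: "nat \<Rightarrow> real^3 \<Rightarrow> real^3"
  proof -
    have U: "bij_betw (\<sigma> n) ?C ?C" "\<sigma> n \<in> Holder_space k \<alpha> ?S" "Holder_norm k \<alpha> ?S (\<sigma> n) \<le> K"
      "inv_closure ?S (\<sigma> n) \<in> Holder_space k \<alpha> ?S" "Holder_norm k \<alpha> ?S (inv_closure ?S (\<sigma> n)) \<le> K" for n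
      using \<sigma> by (auto simp: U_ad_def Holder_diffeos_def image_subset_iff)
    obtain r1 \<Phi> where r1: "strict_mono r1" and \<Phi>: "\<Phi> \<in> Holder_space k \<alpha> ?S" "Holder_norm k \<alpha> ?S \<Phi> \<le> K"
      and lim\<Phi>1: "uniform_limit ?C (\<lambda>n. \<sigma> (r1 n)) \<Phi> sequentially"
      and D\<Phi>1: "\<And>\<beta>. mi_order \<beta> \<le> k \<Longrightarrow>
        uniform_limit ?S (\<lambda>n. mi_deriv \<beta> (\<sigma> (r1 n))) (mi_deriv \<beta> \<Phi>) sequentially"
      by (rule Holder_bounded_subsequence[where f = \<sigma>, OF assms(4,1) U(2,3)]) blast
    \<comment> \<open>The inverses are thinned along \<open>r1\<close>, so that one subsequence
      serves both.\<close>
    obtain r2 \<Psi> where r2: "strict_mono r2" and \<Psi>: "\<Psi> \<in> Holder_space k \<alpha> ?S" "Holder_norm k \<alpha> ?S \<Psi> \<le> K"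
      and lim\<Psi>: "uniform_limit ?C (\<lambda>n. inv_closure ?S (\<sigma> (r1 (r2 n)))) \<Psi> sequentially"
      by (rule Holder_bounded_subsequence[where f = "\<lambda>n. inv_closure ?S (\<sigma> (r1 n))", OF assms(4,1) U(4,5)]) blast
    define r where "r n = r1 (r2 n)" for n
    have r: "strict_mono r" using strict_mono_o[OF r1 r2] by (simp add: o_def r_def[abs_def])
    have lim\<Phi>: "uniform_limit ?C (\<lambda>n. \<sigma> (r n)) \<Phi> sequentially"
      using filterlim_compose[OF lim\<Phi>1 filterlim_subseq[OF r2]] by (simp add: r_def)
    have D\<Phi>: "uniform_limit ?S (\<lambda>n. mi_deriv \<beta> (\<sigma> (r n))) (mi_deriv \<beta> \<Phi>) sequentially" if "mi_order \<beta> \<le> k" for \<beta>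
      using filterlim_compose[OF D\<Phi>1[OF that] filterlim_subseq[OF r2]] by (simp add: r_def)
    have pt: "(\<lambda>n. \<sigma> (r n) x) \<longlonglongrightarrow> \<Phi> x" "(\<lambda>n. inv_closure ?S (\<sigma> (r n)) x) \<longlonglongrightarrow> \<Psi> x" if "x \<in> ?C" for x
      using tendsto_uniform_limitI[OF lim\<Phi> that] tendsto_uniform_limitI[OF lim\<Psi> that] by (auto simp: r_def)
    have inv: "\<sigma> n x \<in> ?C" "inv_closure ?S (\<sigma> n) x \<in> ?C" "\<sigma> n (inv_closure ?S (\<sigma> n) x) = x"
      "inv_closure ?S (\<sigma> n) (\<sigma> n x) = x" if "x \<in> ?C" for n x
      using U(1)[of n] that bij_betwE[OF U(1)[of n]] bij_betwE[OF bij_betw_inv_into[OF U(1)[of n]]]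
        bij_betw_inv_into_right[OF U(1)[of n]] bij_betw_inv_into_left[OF U(1)[of n]]
      by (auto simp: inv_closure_def)
    have in\<Phi>: "\<Phi> x \<in> ?C" and in\<Psi>: "\<Psi> x \<in> ?C" if "x \<in> ?C" for x
      using closed_sequentially[OF closed_closure inv(1)[OF that] pt(1)[OF that]]
        closed_sequentially[OF closed_closure inv(2)[OF that] pt(2)[OF that]] by auto
    have cont: "continuous_on ?C \<Phi>" "continuous_on ?C \<Psi>"
      using \<Phi>(1) \<Psi>(1) by (auto simp: Holder_space_def Ck_closure_def)
    \<comment> \<open>Each inverse applied to its map at \<open>x\<close> is the constant x, while
      the diagonal limit is \<open>\<Psi> (\<Phi> x)\<close>.\<close>
    have \<Psi>\<Phi>: "\<Psi> (\<Phi> x) = x" if "x \<in> ?C" for x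
      using tendsto_uniform_limit_diagonal[OF cont(2) lim\<Psi>[folded r_def] pt(1)[OF that] inv(1)[OF that] in\<Phi>[OF that]]
        inv(4)[OF that] by (simp add: LIMSEQ_const_iff)
    have \<Phi>\<Psi>: "\<Phi> (\<Psi> x) = x" if "x \<in> ?C" for x
      using tendsto_uniform_limit_diagonal[OF cont(1) lim\<Phi> pt(2)[OF that] inv(2)[OF that] in\<Psi>[OF that]]
        inv(3)[OF that] by (simp add: LIMSEQ_const_iff)
    have bij: "bij_betw \<Phi> ?C ?C"
      by (rule bij_betw_byWitness[where f' = \<Psi>]) (use \<Psi>\<Phi> \<Phi>\<Psi> in\<Phi> in\<Psi> in auto)
    \<comment> \<open>Equality as functions, also off the closed ball, is what transfers the
      regularity and the bound K from \<Psi> to the inverse of \<Phi>.\<close>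
    have "inv_closure ?S \<Phi> = \<Psi>"
    proof (rule extensionalityI[of _ ?C])
      show "inv_closure ?S \<Phi> \<in> extensional ?C" "\<Psi> \<in> extensional ?C"
        using \<Psi>(1) by (auto simp: inv_closure_def Holder_space_def)
      show "inv_closure ?S \<Phi> x = \<Psi> x" if "x \<in> ?C" for x
        using inv_into_f_eq[OF bij_betw_imp_inj_on[OF bij] in\<Psi>[OF that] \<Phi>\<Psi>[OF that]] that
        by (simp add: inv_closure_def)
    qed
    then have "\<Phi> \<in> U_ad k \<alpha> K ?S"
      using bij \<Phi> \<Psi> by (simp add: U_ad_def Holder_diffeos_def)
    moreover have "limitin (Holder_topology k \<alpha>' ?S) (\<lambda>n. \<sigma> (r n)) \<Phi> sequentially"
      using U \<Phi> D\<Phi> by (intro limitin_Holder_topology[OF S assms(5,6)]) auto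
    ultimately show ?thesis
      using r by (auto simp: Holder_topology_def o_def)
  qed
  moreover have "U_ad k \<alpha> K ?S \<subseteq> Holder_space k \<alpha>' ?S"
    using Holder_space_mono[OF S(2) assms(6,1)] by (auto simp: U_ad_def Holder_diffeos_def)
  ultimately show ?thesis
    unfolding Holder_topology_def compactin_sequentially by blast
qed

end
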